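(* For $k\ge 0$ and $0\le j\le 2^{\lfloor k/2\rfloor+1}-2$, the atom $V(k,j)$ of the Binary Two-Up Sequence consists of the terms $a(n)$ to $a(n+5)$, where $n=12\mu(k+4)+12j+1$. If $j=0$, let $x=2\mu(k+4)$. Then $$a(n)=2^{2x}+2^{2x+1},\ a(n+1)=2^{4x+2},\ a(n+2)=2^{4x+3},\ a(n+3)=2^{4x+4},\ a(n+4)=2^{x}+2^{2x+2},\ a(n+5)=2^{4x+5},$$ and the term after $V(k,0)$ ends is $a(n+6)=2^{x+1}+2^{2x+3}$. If $j>0$, let $x=\mu(k+4)+j$. Then $$a(n)=2^{2x}+2^{4x+1},\ a(n+1)=2^{8x+2},\ a(n+2)=2^{8x+3},\ a(n+3)=2^{8x+4},\ a(n+4)=2^{x}+2^{4x+2},\ a(n+5)=2^{8x+5},$$ and the term after $V(k,j)$ ends is $a(n+6)=2^{2x+1}+2^{4x+3}$.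
   Context: Two nonnegative integers are perpendicular if their binary expansions have no $1$ in the same bit-position. The Binary Two-Up Sequence $\{a(n)\}_{n\ge 0}$ is defined by: for each $n\ge 0$, $a(n)$ is the smallest nonnegative integer not among $a(0),\ldots,a(n-1)$ that is perpendicular to each of $a(\lceil n/2\rceil),\ldots,a(n-1)$, i.e. to each of the previous $\lfloor n/2\rfloor$ terms. It begins $0,1,2,4,8,3,16,32,64,12,128,\ldots$. The initial term $a(0)=0$ is ignored in the decomposition below. The weight of a nonnegative integer is the number of $1$'s in its binary expansion. $\mu(m)$, $m\ge 1$, denotes the $m$-th term, in increasing order, of the sequence of all numbers of the form $2^i$ ($i\ge0$) or $3\cdot 2^i$ ($i\ge 0$): $\mu(1),\mu(2),\ldots = 1,2,3,4,6,8,12,16,24,32,48,64,\ldots$. Free $1$'s. When $n=2t$ is even, once $a(2t)$ has been determined the powers of $2$ in the binary expansion of $a(t)$ are "freed". Thus the free powers of $2$ after step $n$ are the $2^e$ which occur in the binary expansion of some $a(i)$, $1\le i\le n$, but of none of the terms $a(\lceil (n+1)/2\rceil),\ldots,a(n)$. Atoms. The sequence $a(1),a(2),\ldots$ is cut into consecutive blocks called atoms: an atom ends with the term $a(n)$ exactly when, after step $n$ (including the freeing, if $n$ is even), there are exactly two distinct free powers of $2$ and their sum is a number not among $a(1),\ldots,a(n)$. The code of an atom is obtained by going through its terms $a(i)$ in order and writing $Aw$, where $w$ is the weight of $a(i)$, followed, if $i=2t$ is even, by $Fw'$, where $w'$ is the weight of the freed term $a(t)$. An atom is of type $V$ if its code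 is $A2\,A1\,F2\,A1\,A1\,F1\,A2\,A1\,F1$ (so it consists of $6$ terms). The first atom of type $V$ (terms $a(9),\ldots,a(14)$) is labeled $V(-1)$; the subsequent atoms of type $V$ are labeled, in order of occurrence in the sequence, $V(k,j)$ with $k\ge 0$, $0\le j\le 2^{\lfloor k/2\rfloor+1}-2$, in lexicographic order of $(k,j)$: $V(0,0),V(1,0),V(2,0),V(2,1),V(2,2),V(3,0),V(3,1),V(3,2),V(4,0),\ldots$. *)

theory Defs
  imports Main "HOL-Library.Infinite_Set"
begin

definition perpendicular :: "nat \<Rightarrow> nat \<Rightarrow> bool" where
  "perpendicular m n \<longleftrightarrow> (\<nexists>e. bit m e \<and> bit n e)"

definition weight :: "nat \<Rightarrow> nat" where
  "weight m = card {e. bit m e}"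

(* (n + 1) div 2 is the ceiling of n/2, so the interval holds the previous floor(n/2) indices. *)
fun two_up :: "nat \<Rightarrow> nat" where
  "two_up n = (LEAST m. m \<notin> two_up ` {..<n} \<and>
                 (\<forall>i\<in>{(n + 1) div 2..<n}. perpendicular m (two_up i)))"

declare two_up.simps [simp del]

(* The minimum in the recursion is taken over a nonempty set. *)
lemma two_up_candidate_exists:
  "\<exists>m. m \<notin> two_up ` {..<n} \<and> (\<forall>i\<in>{(n + 1) div 2..<n}. perpendicular m (two_up i))"
proof -
  define E where "E = (\<Sum>i<n. two_up i)"
  have lt: "two_up i < 2 ^ E" if "i < n" for i
  proof -
    have "two_up i \<le> E"
      unfolding E_def using that by (intro member_le_sum) auto
    also have "E < 2 ^ E" by (rule less_exp)
    finally show ?thesis .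
  qed
  have "2 ^ E \<notin> two_up ` {..<n}"
    using lt by fastforce
  moreover have "perpendicular (2 ^ E) (two_up i)" if "i < n" for i
  proof -
    have "\<not> bit (two_up i) E"
      using lt[OF that] by (simp add: bit_iff_odd)
    then show ?thesis
      by (auto simp: perpendicular_def bit_exp_iff)
  qed
  ultimately show ?thesis
    by auto
qed

(* Indexed from 1, whereas enumerate counts from 0; the value at 0 is irrelevant. *)
definition mu :: "nat \<Rightarrow> nat" where
  "mu m = enumerate ({2 ^ i |i. True} \<union> {3 * 2 ^ i |i. True}) (m - 1)"

(* (n + 2) div 2 is the ceiling of (n+1)/2: when n = 2t, the term with index t has been freed. *)
definition free_powers :: "nat \<Rightarrow> nat set" where
  "free_powers n = {2 ^ e |e. (\<exists>i\<in>{1..n}. bit (two_up i) e) \<and>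
                              \<not> (\<exists>i\<in>{(n + 2) div 2..n}. bit (two_up i) e)}"

definition ends_atom :: "nat \<Rightarrow> bool" where
  "ends_atom n \<longleftrightarrow> n \<ge> 1 \<and> card (free_powers n) = 2 \<and> \<Sum>(free_powers n) \<notin> two_up ` {1..n}"

(* An atom is represented by its first index s and last index t. *)
definition is_atom :: "nat \<Rightarrow> nat \<Rightarrow> bool" where
  "is_atom s t \<longleftrightarrow> 1 \<le> s \<and> s \<le> t \<and> (s = 1 \<or> ends_atom (s - 1)) \<and>
                   ends_atom t \<and> (\<forall>i\<in>{s..<t}. \<not> ends_atom i)"

datatype code_symbol = SymA nat | SymF nat

definition atom_code :: "nat \<Rightarrow> nat \<Rightarrow> code_symbol list" where
  "atom_code s t = concat (map (\<lambda>i. SymA (weight (two_up i)) #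
                                  (if even i then [SymF (weight (two_up (i div 2)))] else []))
                               [s..<Suc t])"

definition is_V_type :: "nat \<Rightarrow> nat \<Rightarrow> bool" where
  "is_V_type s t \<longleftrightarrow> is_atom s t \<and>
     atom_code s t = [SymA 2, SymA 1, SymF 2, SymA 1, SymA 1, SymF 1, SymA 2, SymA 1, SymF 1]"

definition V_label :: "nat \<Rightarrow> nat \<Rightarrow> bool" where
  "V_label k j \<longleftrightarrow> j \<le> 2 ^ (k div 2 + 1) - 2"

definition V_label_rank :: "nat \<Rightarrow> nat \<Rightarrow> nat" where
  "V_label_rank k j = card {(k', j'). V_label k' j' \<and> (k' < k \<or> k' = k \<and> j' < j)}"

(* The block from s to t is the atom labeled V(k,j): the type V atoms before it are V(-1),
   which accounts for the 1, and those whose labels are lexicographically smaller. *)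
definition is_V_atom :: "nat \<Rightarrow> nat \<Rightarrow> nat \<Rightarrow> nat \<Rightarrow> bool" where
  "is_V_atom k j s t \<longleftrightarrow> V_label k j \<and> is_V_type s t \<and>
     card {s'. s' < s \<and> (\<exists>t'. is_V_type s' t')} = 1 + V_label_rank k j"

end

theory Submission
  imports Defs "HOL-Library.Nat_Bijection" "HOL-Library.Code_Binary_Nat"
begin

text \<open>
  Identify a number with the set of its binary exponents. Every exponent first occurs alone, so the
  next term is the smallest unused combination of free exponents, or a new singleton if there is
  none. From index 49 on the sequence splits into blocks of twelve terms, at \<open>12y + 1, \<dots>, 12y + 12\<close>
  with \<open>y \<ge> 4\<close>; each block uses eight new exponents, and during block \<open>y\<close> the six terms freed
  belong to one half of block \<open>y div 2\<close>, so that the shape of a block follows from that of an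
  earlier one. If \<open>y + 1\<close> is not of the form \<open>2^i\<close> or \<open>3 * 2^i\<close>, the block is regular: its first
  half is an atom of type V and its second half is an atom of another type. Otherwise it is cut into atoms
  of eight and four terms. Since \<open>y\<close> itself being of this form changes one exponent of the block,
  the cases \<open>j = 0\<close> and \<open>j > 0\<close> arise, and \<open>(k, j) \<mapsto> mu (k + 4) + j\<close> is the increasing enumeration
  of the regular blocks.
\<close>

section \<open>The recursion in terms of free exponents\<close>

definition ones :: "nat \<Rightarrow> nat set" where
  "ones n = set_decode (two_up n)"

lemma bit_two_up_iff: "bit (two_up n) e \<longleftrightarrow> e \<in> ones n"
  by (simp add: ones_def set_decode_def bit_iff_odd)

lemma two_up_eq: "two_up n = set_encode (ones n)"
  by (simp add: ones_def)

lemma finite_ones [simp]: "finite (ones n)"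
  by (simp add: ones_def)

lemma weight_two_up: "weight (two_up n) = card (ones n)"
  by (simp add: weight_def bit_two_up_iff)

lemma perpendicular_iff: "perpendicular m n \<longleftrightarrow> set_decode m \<inter> set_decode n = {}"
  by (auto simp: perpendicular_def set_decode_def bit_iff_odd)

lemma two_up_props:
  "two_up n \<notin> two_up ` {..<n}"
  "i \<in> {(n + 1) div 2..<n} \<Longrightarrow> perpendicular (two_up n) (two_up i)"
proof -
  have "two_up n \<notin> two_up ` {..<n} \<and> (\<forall>i\<in>{(n + 1) div 2..<n}. perpendicular (two_up n) (two_up i))"
    using LeastI_ex[OF two_up_candidate_exists[of n]] unfolding two_up.simps[of n, symmetric] .
  then show "two_up n \<notin> two_up ` {..<n}"
    "i \<in> {(n + 1) div 2..<n} \<Longrightarrow> perpendicular (two_up n) (two_up i)" by auto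
qed

lemma ones_0 [simp]: "ones 0 = {}"
  by (simp add: ones_def two_up.simps[of 0])

lemma ones_inj: "ones i = ones j \<longleftrightarrow> i = j"
proof -
  have "two_up i \<noteq> two_up j" if "i < j" for i j
    using two_up_props(1)[of j] that by (metis image_eqI lessThan_iff)
  then show ?thesis
    by (metis linorder_neqE_nat two_up_eq)
qed

lemma ones_disjoint:
  assumes "i < j" "j \<le> 2 * i"
  shows "ones i \<inter> ones j = {}"
proof -
  have "i \<in> {(j + 1) div 2..<j}" using assms by auto
  from two_up_props(2)[OF this] show ?thesis
    by (simp add: perpendicular_iff ones_def Int_commute)
qed

lemma set_decode_in_ones_iff: "set_decode m \<in> ones ` I \<longleftrightarrow> m \<in> two_up ` I"
  unfolding ones_def image_iff by (metis set_decode_inverse)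

lemma set_encode_in_two_up_iff: "finite X \<Longrightarrow> set_encode X \<in> two_up ` I \<longleftrightarrow> X \<in> ones ` I"
  by (simp flip: set_decode_in_ones_iff)

text \<open>Here \<open>(n + 2) div 2\<close> is the ceiling of (n+1)/2, so the window holds exactly
  the terms that constrain index n+1.\<close>

lemma ones_SucI:
  assumes "finite X" "X \<notin> ones ` {..n}" "\<forall>i\<in>{(n + 2) div 2..n}. X \<inter> ones i = {}"
    and least: "\<And>Y. finite Y \<Longrightarrow> Y \<notin> ones ` {..n} \<Longrightarrow>
      \<forall>i\<in>{(n + 2) div 2..n}. Y \<inter> ones i = {} \<Longrightarrow> set_encode X \<le> set_encode Y"
  shows "ones (Suc n) = X"
proof -
  have not_in: "set_decode m \<notin> ones ` {..n} \<longleftrightarrow> m \<notin> two_up ` {..<Suc n}" for m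
    by (simp add: set_decode_in_ones_iff lessThan_Suc_atMost)
  have range: "{(Suc n + 1) div 2..<Suc n} = {(n + 2) div 2..n}"
    by auto
  have "two_up (Suc n) = set_encode X"
  proof (subst two_up.simps, rule Least_equality)
    have "set_encode X \<notin> two_up ` {..<Suc n}"
      using assms(1,2) not_in[of "set_encode X"] by simp
    then show "set_encode X \<notin> two_up ` {..<Suc n} \<and>
        (\<forall>i\<in>{(Suc n + 1) div 2..<Suc n}. perpendicular (set_encode X) (two_up i))"
      unfolding range using assms(1,3) by (simp add: perpendicular_iff ones_def)
  next
    fix m
    assume "m \<notin> two_up ` {..<Suc n} \<and>
        (\<forall>i\<in>{(Suc n + 1) div 2..<Suc n}. perpendicular m (two_up i))"
    then show "set_encode X \<le> m"
      unfolding range using least[of "set_decode m"] not_in[of m]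
      by (simp add: perpendicular_iff ones_def)
  qed
  then show ?thesis
    using assms(1) by (simp add: ones_def)
qed

definition free_exps :: "nat \<Rightarrow> nat set" where
  "free_exps n = {e. (\<exists>i\<in>{1..n}. e \<in> ones i) \<and> (\<forall>i\<in>{(n + 2) div 2..n}. e \<notin> ones i)}"

lemma finite_free_exps [simp]: "finite (free_exps n)"
  by (rule finite_subset[of _ "\<Union>i\<in>{1..n}. ones i"]) (auto simp: free_exps_def)

lemma free_powers_eq: "free_powers n = (\<lambda>e. 2 ^ e) ` free_exps n"
  by (auto simp: free_powers_def free_exps_def bit_two_up_iff)

lemma ends_atom_iff:
  "ends_atom n \<longleftrightarrow> n \<ge> 1 \<and> card (free_exps n) = 2 \<and> free_exps n \<notin> ones ` {..n}"
proof -
  have "\<Sum>(free_powers n) = set_encode (free_exps n)"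
    by (simp add: free_powers_eq set_encode_def sum.reindex inj_on_def)
  moreover have "card (free_powers n) = card (free_exps n)"
    by (simp add: free_powers_eq card_image inj_on_def)
  moreover have "set_encode (free_exps n) \<notin> two_up ` {1..n} \<longleftrightarrow> free_exps n \<notin> ones ` {1..n}"
    by (simp add: set_encode_in_two_up_iff)
  moreover have "{..n} = insert 0 {1..n}"
    by auto
  ultimately show ?thesis
    by (auto simp: ends_atom_def)
qed

text \<open>The invariant of the recursion. \<open>M\<close> is the next new exponent: none from
  \<open>M\<close> on has occurred, and each one below \<open>M\<close> has already been a term by
  itself.\<close>

definition state :: "nat \<Rightarrow> nat \<Rightarrow> nat set \<Rightarrow> bool" where
  "state n M F \<longleftrightarrow> free_exps n = F \<and> (\<forall>i\<in>{1..n}. ones i \<subseteq> {..<M}) \<and> (\<forall>e<M. {e} \<in> ones ` {..n})"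

definition freed :: "nat \<Rightarrow> nat set" where
  "freed n = (if even n then ones (n div 2) else {})"

lemma state_free_less:
  assumes "state n M F" "e \<in> F"
  shows "e < M"
  using assms by (auto simp: state_def free_exps_def)

lemma state_bound:
  assumes "state n M F" "i \<le> n" "e \<in> ones i"
  shows "e < M"
  using assms by (cases i) (auto simp: state_def)

text \<open>An exponent below \<open>M\<close> has occurred, so it is either free or blocked by the
  window; exponents from \<open>M\<close> on are blocked by nothing.\<close>

lemma state_perpendicular_iff:
  assumes "state n M F"
  shows "(\<forall>i\<in>{(n + 2) div 2..n}. X \<inter> ones i = {}) \<longleftrightarrow> X \<subseteq> F \<union> {M..}"
proof
  assume L: "\<forall>i\<in>{(n + 2) div 2..n}. X \<inter> ones i = {}"
  show "X \<subseteq> F \<union> {M..}"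
  proof
    fix e assume e: "e \<in> X"
    show "e \<in> F \<union> {M..}"
    proof (cases "e < M")
      case True
      then obtain i where "i \<le> n" "ones i = {e}"
        using assms by (auto simp: state_def)
      moreover from this have "i \<noteq> 0" by (auto intro: ccontr)
      ultimately have "\<exists>i\<in>{1..n}. e \<in> ones i" by force
      then have "e \<in> free_exps n"
        using L e by (auto simp: free_exps_def)
      then show ?thesis using assms by (simp add: state_def)
    qed simp
  qed
next
  assume R: "X \<subseteq> F \<union> {M..}"
  show "\<forall>i\<in>{(n + 2) div 2..n}. X \<inter> ones i = {}"
  proof (intro ballI)
    fix i assume i: "i \<in> {(n + 2) div 2..n}"
    have "e \<notin> ones i" if "e \<in> X" for e
    proof (cases "e \<in> F")
      case True
      then show ?thesis using assms i by (auto simp: state_def free_exps_def)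
    next
      case False
      then show ?thesis
        using R that i state_bound[OF assms, of i e] by fastforce
    qed
    then show "X \<inter> ones i = {}" by auto
  qed
qed

lemma set_encode_less:
  assumes "X \<subseteq> {..<M}"
  shows "set_encode X < 2 ^ M"
proof -
  have "set_encode X \<le> set_encode {..<M}"
    using assms finite_subset[OF assms] by (auto simp: set_encode_def intro!: sum_mono2)
  also have "\<dots> = 2 ^ M - 1"
    by (simp add: set_encode_def lessThan_atLeast0 sum_power2)
  also have "\<dots> < 2 ^ M"
    by simp
  finally show ?thesis .
qed

lemma set_encode_ge:
  assumes "finite X" "e \<in> X"
  shows "2 ^ e \<le> set_encode X"
  using assms by (auto simp: set_encode_def intro: member_le_sum)

lemma free_exps_Suc:
  "free_exps (Suc n) = (free_exps n - ones (Suc n)) \<union> freed (Suc n)"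
proof (cases "even n")
  case True
  then obtain t where t: "n = 2 * t" by auto
  have "{1..Suc n} = insert (Suc n) {1..n}" "{(Suc n + 2) div 2..Suc n} = insert (Suc n) {(n + 2) div 2..n}"
    using t by auto
  then show ?thesis
    using True by (auto simp: free_exps_def freed_def)
next
  case False
  then obtain t where t: "n = 2 * t + 1" by (elim oddE)
  then have n: "Suc n = 2 * (t + 1)" by simp
  \<comment> \<open>The window loses a term only when the new index is even, here
    \<open>t + 1\<close>. That term is disjoint from everything after it up to twice its index, so
    all its exponents become free at once.\<close>
  have disj: "ones (t + 1) \<inter> ones i = {}" if "i \<in> {t + 2..Suc n}" for i
    using that n by (intro ones_disjoint) auto
  have 1: "{1..Suc n} = insert (Suc n) {1..n}"
    by auto
  have 2: "{(n + 2) div 2..n} = insert (t + 1) ({t + 2..n})" "(Suc n + 2) div 2 = t + 2"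
    using t by auto
  have 3: "{t + 2..Suc n} = insert (Suc n) {t + 2..n}"
    using t by auto
  have fr: "freed (Suc n) = ones (t + 1)"
    unfolding n freed_def by simp
  have in1: "t + 1 \<in> {1..n}" using t by simp
  have "e \<in> free_exps (Suc n) \<longleftrightarrow> e \<in> (free_exps n - ones (Suc n)) \<union> ones (t + 1)" for e
    using disj in1 unfolding free_exps_def 1 2 3 by blast
  then show ?thesis unfolding fr by blast
qed

lemma composite_step:
  assumes st: "state n M F" and n: "m = Suc n"
    and X: "X \<subseteq> F" "X \<notin> ones ` {..n}"
    and least: "\<And>Y. Y \<subseteq> F \<Longrightarrow> Y \<notin> ones ` {..n} \<Longrightarrow> set_encode X \<le> set_encode Y"
  shows "ones m = X" "state m M ((F - X) \<union> freed m)"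
proof -
  have XM: "X \<subseteq> {..<M}"
    using X state_free_less[OF st] by auto
  show eq: "ones m = X"
    unfolding n
  proof (rule ones_SucI)
    show "finite X" by (rule finite_subset[OF XM]) simp
    show "X \<notin> ones ` {..n}" by (rule X)
    show "\<forall>i\<in>{(n + 2) div 2..n}. X \<inter> ones i = {}"
      using X by (subst state_perpendicular_iff[OF st]) auto
    fix Y :: "nat set"
    assume Y: "finite Y" "Y \<notin> ones ` {..n}" "\<forall>i\<in>{(n + 2) div 2..n}. Y \<inter> ones i = {}"
    from Y(3) have "Y \<subseteq> F \<union> {M..}"
      by (simp only: state_perpendicular_iff[OF st])
    then consider "Y \<subseteq> F" | e where "e \<in> Y" "e \<ge> M"
      by blast
    then show "set_encode X \<le> set_encode Y"
    proof cases
      case 1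
      then show ?thesis using least Y by blast
    next
      case 2
      have "set_encode X < 2 ^ M" by (rule set_encode_less[OF XM])
      also have "(2::nat) ^ M \<le> 2 ^ e" using 2 by simp
      also have "\<dots> \<le> set_encode Y" using 2 Y by (simp add: set_encode_ge)
      finally show ?thesis by simp
    qed
  qed
  show "state m M ((F - X) \<union> freed m)"
    using st XM n eq by (auto simp: state_def free_exps_Suc atMost_Suc atLeastAtMostSuc_conv)
qed

text \<open>Every candidate now needs an exponent from \<open>M\<close> on, and the singleton
  \<open>{M}\<close> is the smallest such set.\<close>

lemma new_step:
  assumes st: "state n M F" and n: "m = Suc n"
    and used: "\<And>Y. Y \<subseteq> F \<Longrightarrow> Y \<in> ones ` {..n}"
  shows "ones m = {M}" "state m (Suc M) (F \<union> freed m)"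
proof -
  have notM: "M \<notin> ones i" if "i \<le> n" for i
    using state_bound[OF st that] by blast
  show eq: "ones m = {M}"
    unfolding n
  proof (rule ones_SucI)
    show "{M} \<notin> ones ` {..n}" using notM by auto
    show "\<forall>i\<in>{(n + 2) div 2..n}. {M} \<inter> ones i = {}"
      by (subst state_perpendicular_iff[OF st]) auto
    fix Y :: "nat set"
    assume Y: "finite Y" "Y \<notin> ones ` {..n}" "\<forall>i\<in>{(n + 2) div 2..n}. Y \<inter> ones i = {}"
    from Y(3) have "Y \<subseteq> F \<union> {M..}"
      by (simp only: state_perpendicular_iff[OF st])
    then obtain e where e: "e \<in> Y" "e \<ge> M"
      using used Y(2) by blast
    then have "(2::nat) ^ M \<le> 2 ^ e" by simp
    also have "\<dots> \<le> set_encode Y" using e Y by (simp add: set_encode_ge)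
    finally show "set_encode {M} \<le> set_encode Y" by simp
  qed simp
  have "M \<notin> F" using state_free_less[OF st] by blast
  moreover have "ones i \<subseteq> {..<Suc M}" if "i \<in> {1..n}" for i
    using st that by (fastforce simp: state_def less_Suc_eq)
  ultimately show "state m (Suc M) (F \<union> freed m)"
    using st n eq by (auto simp: state_def free_exps_Suc atMost_Suc atLeastAtMostSuc_conv less_Suc_eq)
qed

section \<open>The first 96 terms\<close>

definition desc_list :: "nat set \<Rightarrow> nat list" where
  "desc_list X = rev (sorted_list_of_set X)"

fun subs :: "nat list \<Rightarrow> nat list list" where
  "subs [] = [[]]"
| "subs (f # fs) = subs fs @ map ((#) f) (subs fs)"

lemma set_desc_list [simp]: "finite X \<Longrightarrow> set (desc_list X) = X"
  by (simp add: desc_list_def)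

lemma desc_list_inject: "finite X \<Longrightarrow> finite Y \<Longrightarrow> desc_list X = desc_list Y \<longleftrightarrow> X = Y"
  by (metis set_desc_list)

lemma desc_list_set: "sorted_wrt (>) xs \<Longrightarrow> desc_list (set xs) = xs"
proof -
  assume "sorted_wrt (>) xs"
  then have "sorted_wrt (<) (rev xs)" by (simp add: sorted_wrt_rev)
  then show ?thesis
    using sorted_list_of_set.idem_if_sorted_distinct[of "rev xs"]
    by (simp add: desc_list_def strict_sorted_iff)
qed

lemma sorted_desc_list: "finite X \<Longrightarrow> sorted_wrt (>) (desc_list X)"
  by (simp add: desc_list_def sorted_wrt_rev strict_sorted_iff)

lemma sorted_wrt_subs: "sorted_wrt (>) xs \<Longrightarrow> Y \<in> set (subs xs) \<Longrightarrow> sorted_wrt (>) Y \<and> set Y \<subseteq> set xs"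
  by (induction xs arbitrary: Y) fastforce+

lemma desc_list_in_subs: "sorted_wrt (>) xs \<Longrightarrow> Y \<subseteq> set xs \<Longrightarrow> desc_list Y \<in> set (subs xs)"
proof (induction xs arbitrary: Y)
  case Nil
  then show ?case by (simp add: desc_list_def)
next
  case (Cons x xs)
  show ?case
  proof (cases "x \<in> Y")
    case True
    let ?ys = "desc_list (Y - {x})"
    have fin: "finite (Y - {x})" and Yx: "Y - {x} \<subseteq> set xs"
      using Cons.prems finite_subset by fastforce+
    have "sorted_wrt (>) (x # ?ys)"
      using Cons.prems Yx fin sorted_desc_list[OF fin] by auto
    from desc_list_set[OF this] have "desc_list Y = x # ?ys"
      using True fin by (simp add: insert_absorb)
    then show ?thesis
      using Cons.IH[OF _ Yx] Cons.prems by auto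
  next
    case False
    then show ?thesis using Cons by auto
  qed
qed

lemma sorted_set_encode_subs:
  "sorted_wrt (>) xs \<Longrightarrow> sorted_wrt (\<lambda>X Y. set_encode (set X) < set_encode (set Y)) (subs xs)"
proof (induction xs)
  case Nil
  then show ?case by simp
next
  case (Cons x xs)
  have lt: "set Y \<subseteq> {..<x}" if "Y \<in> set (subs xs)" for Y
    using sorted_wrt_subs[OF _ that] Cons.prems by auto
  have enc: "set_encode (insert x (set Y)) = 2 ^ x + set_encode (set Y)" if "Y \<in> set (subs xs)" for Y
    using lt[OF that] by (intro set_encode_insert) auto
  \<comment> \<open>Everything below the exponent \<open>x\<close> sums to less than 2^x.\<close>
  have "set_encode (set X) < set_encode (set (x # Y))" if "X \<in> set (subs xs)" "Y \<in> set (subs xs)" for X Y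
    using set_encode_less[OF lt[OF that(1)]] enc[OF that(2)] by simp
  then show ?case
    using Cons enc by (auto simp: sorted_wrt_append sorted_wrt_map elim!: sorted_wrt_mono_rel[rotated])
qed

section \<open>Executable simulation of the recursion\<close>

type_synonym history = "nat list list \<times> nat list \<times> nat \<times> nat list"

(* All terms so far (latest first), the free exponents, the number of exponents in use, and the
   positions at which an atom has ended (latest first). *)
fun history_step :: "history \<Rightarrow> history" where
  "history_step (hs, F, M, E) =
    (let m = length hs;
         fr = (if even m then hs ! (m - 1 - m div 2) else []);
         (X, M') = (case find (\<lambda>X. X \<notin> set hs) (subs F) of Some X \<Rightarrow> (X, M) | None \<Rightarrow> ([M], Suc M));
         F' = desc_list (set (filter (\<lambda>e. e \<notin> set X) F @ fr));
         hs' = X # hs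
     in (hs', F', M', if length F' = 2 \<and> F' \<notin> set hs' then m # E else E))"

definition represents :: "nat \<Rightarrow> history \<Rightarrow> bool" where
  "represents n h \<longleftrightarrow> (\<exists>M. state n M (free_exps n) \<and>
     h = (map (\<lambda>i. desc_list (ones i)) (rev [0..<Suc n]), desc_list (free_exps n), M,
          filter ends_atom (rev [0..<Suc n])))"

lemma represents_0: "represents 0 ([[]], [], 0, [])"
  by (simp add: represents_def state_def free_exps_def desc_list_def ends_atom_def)

lemma represents_step:
  assumes "represents n h"
  shows "represents (Suc n) (history_step h)"
proof -
  define F where "F = desc_list (free_exps n)"
  define hs where "hs = map (\<lambda>i. desc_list (ones i)) (rev [0..<Suc n])"
  obtain M where st: "state n M (free_exps n)"
    and h: "h = (hs, F, M, filter ends_atom (rev [0..<Suc n]))"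
    using assms by (auto simp: represents_def F_def hs_def)
  have F: "sorted_wrt (>) F" "set F = free_exps n"
    by (simp_all add: F_def sorted_desc_list)
  have in_hs: "desc_list X \<in> set hs \<longleftrightarrow> X \<in> ones ` {..n}" if "finite X" for X
    using that by (auto simp: hs_def desc_list_inject image_iff less_Suc_eq_le simp del: upt_Suc)
  have len: "length hs = Suc n"
    by (simp add: hs_def)
  define fr where "fr = (if even (Suc n) then hs ! (Suc n - 1 - Suc n div 2) else [])"
  have fr: "set fr = freed (Suc n)"
  proof (cases "even (Suc n)")
    case True
    \<comment> \<open>The list is stored latest first: position p holds the term of index n -
      p.\<close>
    then have "n - Suc n div 2 < Suc n" "n - (n - Suc n div 2) = Suc n div 2" by presburger+
    then have "hs ! (n - Suc n div 2) = desc_list (ones (Suc n div 2))"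
      by (simp add: hs_def rev_map[symmetric] rev_nth del: upt_Suc)
    then show ?thesis using True by (simp add: fr_def freed_def)
  qed (simp add: fr_def freed_def)
  obtain X M' where XM: "(case find (\<lambda>X. X \<notin> set hs) (subs F) of Some X \<Rightarrow> (X, M) | None \<Rightarrow> ([M], Suc M)) = (X, M')"
    by fastforce
  have *: "X = desc_list (ones (Suc n)) \<and> state (Suc n) M' (set (filter (\<lambda>e. e \<notin> set X) F @ fr))"
  proof (cases "find (\<lambda>X. X \<notin> set hs) (subs F)")
    case None
    then have XM: "X = [M]" "M' = Suc M" using XM by auto
    have "Y \<in> ones ` {..n}" if "Y \<subseteq> free_exps n" for Y
      using that None desc_list_in_subs[OF F(1), of Y] in_hs[of Y] finite_subset[OF that]
      by (auto simp: find_None_iff F(2))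
    from new_step[OF st refl this] have new: "ones (Suc n) = {M}" "state (Suc n) (Suc M) (free_exps n \<union> freed (Suc n))"
      by auto
    have "M \<notin> free_exps n" using state_free_less[OF st] by blast
    then have "set (filter (\<lambda>e. e \<notin> set X) F @ fr) = free_exps n \<union> freed (Suc n)"
      using XM F fr by auto
    with new XM show ?thesis
      by (simp add: desc_list_def)
  next
    case (Some Z)
    then have XM: "Z = X" "M' = M" using XM by auto
    from Some obtain i where i: "i < length (subs F)" "X \<notin> set hs" "X = subs F ! i"
      "\<And>j. j < i \<Longrightarrow> subs F ! j \<in> set hs"
      by (auto simp: find_Some_iff XM)
    then have X: "sorted_wrt (>) X" "set X \<subseteq> free_exps n"
      using sorted_wrt_subs[OF F(1), of X] F(2) by auto
    have XD: "desc_list (set X) = X" using X by (rule_tac desc_list_set)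
    have least: "set_encode (set X) \<le> set_encode Y" if Y: "Y \<subseteq> free_exps n" "Y \<notin> ones ` {..n}" for Y
    proof -
      have fin: "finite Y" using Y(1) by (rule finite_subset) simp
      obtain j where j: "j < length (subs F)" "subs F ! j = desc_list Y"
        using desc_list_in_subs[OF F(1), of Y] Y F(2) by (auto simp: in_set_conv_nth)
      then have "\<not> j < i" using i(4)[of j] Y in_hs[OF fin] by auto
      then have "i = j \<or> i < j" by auto
      then show ?thesis
      proof
        assume "i < j"
        then show ?thesis
          using sorted_wrt_nth_less[OF sorted_set_encode_subs[OF F(1)], of i j] j i fin by simp
      qed (use i j fin in auto)
    qed
    have "set X \<notin> ones ` {..n}"
      using in_hs[of "set X"] XD i by simp
    from composite_step[OF st refl X(2) this least]
    have "ones (Suc n) = set X" "state (Suc n) M (free_exps n - set X \<union> freed (Suc n))" by auto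
    moreover have "set (filter (\<lambda>e. e \<notin> set X) F @ fr) = free_exps n - set X \<union> freed (Suc n)"
      using F fr by auto
    ultimately show ?thesis using XD XM by simp
  qed
  then have F': "set (filter (\<lambda>e. e \<notin> set X) F @ fr) = free_exps (Suc n)"
    by (simp only: state_def)
  have hs': "X # hs = map (\<lambda>i. desc_list (ones i)) (rev [0..<Suc (Suc n)])"
    using * by (simp add: hs_def)
  have "ends_atom (Suc n) \<longleftrightarrow> length (desc_list (free_exps (Suc n))) = 2 \<and> desc_list (free_exps (Suc n)) \<notin> set (X # hs)"
  proof -
    have "desc_list (free_exps (Suc n)) \<notin> set (X # hs) \<longleftrightarrow> free_exps (Suc n) \<notin> ones ` {..Suc n}"
      unfolding hs' by (auto simp: desc_list_inject image_iff less_Suc_eq_le simp del: upt_Suc)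
    then show ?thesis
      by (simp add: ends_atom_iff desc_list_def)
  qed
  moreover have "history_step h = (X # hs, desc_list (free_exps (Suc n)), M',
      if length (desc_list (free_exps (Suc n))) = 2 \<and> desc_list (free_exps (Suc n)) \<notin> set (X # hs)
      then Suc n # filter ends_atom (rev [0..<Suc n]) else filter ends_atom (rev [0..<Suc n]))"
    unfolding h history_step.simps Let_def len fr_def[symmetric] XM prod.case F' ..
  ultimately have "history_step h = (X # hs, desc_list (free_exps (Suc n)), M', filter ends_atom (rev [0..<Suc (Suc n)]))"
    by simp
  moreover have "state (Suc n) M' (free_exps (Suc n))"
    using * unfolding F' by blast
  ultimately show ?thesis
    unfolding represents_def hs' by blast
qed

text \<open>Exponents of the terms 0 to 96, each list descending as \<open>desc_list\<close>
  produces it. Index 96 ends block 7, the last block of the induction base.\<close>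

definition initial_terms :: "nat list list" where
  "initial_terms =
    [[], [0], [1], [2], [3], [1,0], [4], [5], [6], [3,2], [7], [8], [9], [4,0], [10], [5,1],
    [11], [12], [13], [6,2], [14], [7,3], [15], [16], [17], [9,8], [18], [19], [20], [10,0],
    [21], [4,1], [22], [11,5], [23], [24], [25], [13,12], [26], [27], [28], [14,2], [29],
    [6,3], [30], [15,7], [31], [32], [33], [17,16], [34], [35], [36], [18,8], [37], [19,9],
    [38], [39], [40], [20,0], [41], [21,10], [42], [43], [44], [22,1], [45], [5,4], [46],
    [23,11], [47], [48], [49], [25,24], [50], [51], [52], [26,12], [53], [27,13], [54], [55],
    [56], [28,2], [57], [29,14], [58], [59], [60], [30,3], [61], [7,6], [62], [31,15], [63],
    [64], [65]]"

lemma history_96: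
  "(history_step ^^ 96) ([[]], [], 0, []) =
     (rev initial_terms, [33, 32], 66, [96, 92, 84, 78, 72, 68, 60, 54, 48, 44, 36, 32, 24, 20, 14, 8, 4])"
  by code_simp

lemma represents_history: "represents n ((history_step ^^ n) ([[]], [], 0, []))"
  by (induction n) (simp_all add: represents_0 represents_step)

lemma ones_singleton_fresh:
  assumes "ones t = {e}" "i \<le> 2 * t" "e \<in> ones i"
  shows "ones i = {e}"
proof -
  obtain n where t: "t = Suc n" using assms(1) by (cases t) auto
  obtain M where st: "state n M (free_exps n)"
    using represents_history[of n] by (auto simp: represents_def)
  have "{e} \<notin> ones ` {..n}"
    using t ones_inj by (auto simp flip: assms(1))
  then have "e \<ge> M"
    using st by (auto simp: state_def intro: leI)
  then have "\<not> i < t"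
    using t state_bound[OF st, of i e] assms(3) by auto
  then have "i = t \<or> t < i" by auto
  then show ?thesis
    using assms ones_disjoint[of t i] by auto
qed

lemma initial_history:
  "map (\<lambda>i. desc_list (ones i)) [0..<97] = initial_terms"
  "state 96 66 {32, 33}"
  "filter ends_atom (rev [0..<97]) = [96, 92, 84, 78, 72, 68, 60, 54, 48, 44, 36, 32, 24, 20, 14, 8, 4]"
proof -
  have *: "represents 96 (rev initial_terms, [33, 32], 66, [96, 92, 84, 78, 72, 68, 60, 54, 48, 44, 36, 32, 24, 20, 14, 8, 4])"
    using represents_history[of 96] by (simp only: history_96)
  then show "map (\<lambda>i. desc_list (ones i)) [0..<97] = initial_terms"
    by (simp add: represents_def rev_map[symmetric] del: upt_Suc upt_rec_numeral)
  from * show "filter ends_atom (rev [0..<97]) = [96, 92, 84, 78, 72, 68, 60, 54, 48, 44, 36, 32, 24, 20, 14, 8, 4]"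
    by (simp add: represents_def del: upt_Suc upt_rec_numeral)
  from * have "[33, 32] = desc_list (free_exps 96)" "state 96 66 (free_exps 96)"
    by (simp_all add: represents_def del: upt_Suc upt_rec_numeral)
  moreover have "free_exps 96 = set (desc_list (free_exps 96))" by simp
  ultimately show "state 96 66 {32, 33}"
    by (metis insert_commute list.simps(15) set_empty2)
qed

lemma initial_ones:
  assumes "i \<le> 96"
  shows "ones i = set (initial_terms ! i)"
proof -
  have "initial_terms ! i = desc_list (ones i)"
    unfolding initial_history(1)[symmetric] using assms by (simp del: upt_rec_numeral)
  then show ?thesis by simp
qed

lemma initial_ends:
  assumes "i \<le> 96"
  shows "ends_atom i \<longleftrightarrow> i \<in> {96, 92, 84, 78, 72, 68, 60, 54, 48, 44, 36, 32, 24, 20, 14, 8, 4}"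
proof -
  have "ends_atom i \<longleftrightarrow> i \<in> set (filter ends_atom (rev [0..<97]))"
    using assms by (simp del: upt_rec_numeral)
  then show ?thesis unfolding initial_history(3) by simp
qed

section \<open>Blocks of twelve terms\<close>

text \<open>The main tool for showing that a pair is still available: up to index
  \<open>2 * t\<close> the exponent \<open>e\<close> has occurred only alone.\<close>

lemma fresh_pair_unused:
  assumes "ones t = {e}" "n \<le> 2 * t" "d \<noteq> e"
  shows "{d, e} \<notin> ones ` {..n}"
proof
  assume "{d, e} \<in> ones ` {..n}"
  then obtain i where i: "i \<le> n" "{d, e} = ones i" by auto
  then have "ones i = {e}"
    using ones_singleton_fresh[OF assms(1), of i] assms(2) by auto
  with i assms(3) show False by auto
qed

lemma empty_used: "{} \<in> ones ` {..n}"
  by (rule image_eqI[of _ _ 0]) auto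

lemma singleton_used: "state n M F \<Longrightarrow> e \<in> F \<Longrightarrow> {e} \<in> ones ` {..n}"
  using state_free_less[of n M F e] by (simp add: state_def)

section \<open>Single steps with at most three free exponents\<close>

lemma new_step_0:
  assumes "state n M {}" "freed m = G" "m = Suc n" "M' = Suc M"
  shows "ones m = {M} \<and> state m M' G"
  using new_step[OF assms(1,3)] empty_used assms by auto

lemma new_step_1:
  assumes st: "state n M {e}" and "freed m = G" "m = Suc n" "M' = Suc M" "F' = insert e G"
  shows "ones m = {M} \<and> state m M' F'"
proof -
  have "Y \<in> ones ` {..n}" if "Y \<subseteq> {e}" for Y
    using that singleton_used[OF st, of e] empty_used[of n] by (auto simp only: subset_singleton_iff insert_iff)
  then show ?thesis
    using new_step[OF st assms(3)] assms by auto
qed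

lemma new_step_2:
  assumes st: "state n M {e, f}" and "{e, f} \<in> ones ` {..n}"
    and "freed m = G" "m = Suc n" "M' = Suc M" "F' = {e, f} \<union> G"
  shows "ones m = {M} \<and> state m M' F'"
proof -
  have "Y \<in> ones ` {..n}" if "Y \<subseteq> {e, f}" for Y
  proof -
    have "Y = {} \<or> Y = {e} \<or> Y = {f} \<or> Y = {e, f}" using that by blast
    then show ?thesis
      using singleton_used[OF st, of e] singleton_used[OF st, of f] empty_used[of n] assms(2)
      by (auto simp only: insert_iff)
  qed
  then show ?thesis
    using new_step[OF st assms(4)] assms by auto
qed

lemma pair_step_2:
  assumes st: "state n M {e, f}" and unused: "{e, f} \<notin> ones ` {..n}"
    and "freed m = G" "m = Suc n"
  shows "ones m = {e, f} \<and> state m M G"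
proof -
  have least: "set_encode {e, f} \<le> set_encode Y" if "Y \<subseteq> {e, f}" "Y \<notin> ones ` {..n}" for Y
  proof -
    have "Y = {} \<or> Y = {e} \<or> Y = {f} \<or> Y = {e, f}" using that by blast
    then have "Y = {e, f}"
      using that singleton_used[OF st, of e] singleton_used[OF st, of f] empty_used[of n]
      by (auto simp only: insert_iff)
    then show ?thesis by simp
  qed
  show ?thesis
    using composite_step[OF st assms(4) order_refl unused least] assms by auto
qed

text \<open>A subset lacking \<open>e\<close> or \<open>g\<close> is empty, a singleton,
  \<open>{e, f}\<close> or \<open>{f, g}\<close>. All are used, except possibly
  \<open>{f, g}\<close>, which then is larger than \<open>{e, g}\<close> because
  \<open>e < f\<close>. The alternative about \<open>{f, g}\<close> serves exceptional blocks, where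
  the order of \<open>e\<close> and \<open>f\<close> is unknown.\<close>

lemma pair_step_3:
  assumes st: "state n M F" and F: "F = {e, f, g}" "e \<noteq> f" "e < g" "f < g"
    and used: "{e, f} \<in> ones ` {..n}" "e < f \<or> {f, g} \<in> ones ` {..n}"
    and unused: "{e, g} \<notin> ones ` {..n}"
    and "freed m = G" "m = Suc n" "F' = insert f G"
  shows "ones m = {e, g} \<and> state m M F'"
proof -
  have least: "set_encode {e, g} \<le> set_encode Y" if Y: "Y \<subseteq> F" "Y \<notin> ones ` {..n}" for Y
  proof -
    have fin: "finite Y" using Y(1) F(1) finite_subset by auto
    have sing: "{e} \<in> ones ` {..n}" "{f} \<in> ones ` {..n}" "{g} \<in> ones ` {..n}"
      using singleton_used[OF st] F(1) by auto
    show ?thesis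
    proof (cases "{e, g} \<subseteq> Y")
      case True
      then show ?thesis
        using fin by (auto simp: set_encode_def intro!: sum_mono2)
    next
      case False
      then have "Y = {} \<or> Y = {e} \<or> Y = {f} \<or> Y = {g} \<or> Y = {e, f} \<or> Y = {f, g}"
        using Y(1) F(1) by blast
      then have "Y = {f, g}" "e < f"
        using Y(2) sing empty_used[of n] used by auto
      then show ?thesis
        using F by simp
    qed
  qed
  have sub: "{e, g} \<subseteq> F" using F by auto
  have "F - {e, g} = {f}" using F by auto
  then show ?thesis
    using composite_step[OF st assms(10) sub unused least] assms by auto
qed

section \<open>The two halves of a block\<close>

lemma state_ends_atom_iff:
  "state n M F \<Longrightarrow> ends_atom n \<longleftrightarrow> n \<ge> 1 \<and> card F = 2 \<and> F \<notin> ones ` {..n}"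
  by (simp add: ends_atom_iff state_def)

lemma freed_odd: "odd n \<Longrightarrow> freed n = {}"
  by (simp add: freed_def)

lemma freed_even: "n = 2 * t \<Longrightarrow> freed n = ones t"
  by (simp add: freed_def)

lemma used_image: "ones i = X \<Longrightarrow> i \<le> n \<Longrightarrow> X \<in> ones ` {..n}"
  by auto

text \<open>Block \<open>y\<close> frees the terms 6y+1 to 6y+6. The shape of the term at 6y+3 is
  left open: it decides whether the block is regular or exceptional.\<close>

lemma block_first_half:
  fixes y :: nat
  assumes y: "y \<ge> 1" and s0: "state (12*y) (8*y+2) {c, 4*y+1}" and c: "c \<noteq> 4*y+1"
    and o0: "ones (6*y) = {4*y+1}" and o1: "ones (6*y+1) = {a, b}"
    and ab: "a < b" "b < 4*y+2" and o2: "ones (6*y+2) = {4*y+2}"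
  shows "ones (12*y+1) = {c, 4*y+1}" "ones (12*y+2) = {8*y+2}" "ones (12*y+3) = {8*y+3}"
    "ones (12*y+4) = {8*y+4}" "ones (12*y+5) = {a, 4*y+2}" "ones (12*y+6) = {8*y+5}"
    "state (12*y+6) (8*y+6) (insert b (ones (6*y+3)))"
    "\<forall>i\<in>{1..5}. \<not> ends_atom (12*y+i)"
proof -
  have f: "freed (12*y+1) = {}" "freed (12*y+2) = {a, b}" "freed (12*y+3) = {}"
    "freed (12*y+4) = {4*y+2}" "freed (12*y+5) = {}" "freed (12*y+6) = ones (6*y+3)"
    using freed_even[of "12*y+2" "6*y+1"] freed_even[of "12*y+4" "6*y+2"]
      freed_even[of "12*y+6" "6*y+3"] o1 o2 by (simp_all add: freed_odd)
  have 1: "ones (12*y+1) = {c, 4*y+1} \<and> state (12*y+1) (8*y+2) {}"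
    by (rule pair_step_2[OF s0 _ f(1)]) (use fresh_pair_unused[OF o0, of "12*y" c] c in auto)
  then have s1: "state (12*y+1) (8*y+2) {}" by simp
  have 2: "ones (12*y+2) = {8*y+2} \<and> state (12*y+2) (8*y+3) {a, b}"
    by (rule new_step_0[OF s1 f(2)]) auto
  then have s2: "state (12*y+2) (8*y+3) {a, b}" by simp
  \<comment> \<open>The freed pair is itself the term at 6y+1 and cannot recur, which forces new
    singletons until 4y+2 is freed.\<close>
  have ab_used: "{a, b} \<in> ones ` {..n}" if "n \<ge> 6*y+1" for n
    using used_image[OF o1 that] .
  have 3: "ones (12*y+3) = {8*y+3} \<and> state (12*y+3) (8*y+4) {a, b}"
    by (rule new_step_2[OF s2 _ f(3)]) (use ab_used in auto)
  then have s3: "state (12*y+3) (8*y+4) {a, b}" by simp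
  have 4: "ones (12*y+4) = {8*y+4} \<and> state (12*y+4) (8*y+5) {a, b, 4*y+2}"
    by (rule new_step_2[OF s3 _ f(4)]) (use ab_used in auto)
  then have s4: "state (12*y+4) (8*y+5) {a, b, 4*y+2}" by simp
  have 5: "ones (12*y+5) = {a, 4*y+2} \<and> state (12*y+5) (8*y+5) {b}"
    by (rule pair_step_3[OF s4 refl _ _ _ _ _ _ f(5)])
      (use ab ab_used fresh_pair_unused[OF o2, of "12*y+4" a] in auto)
  then have s5: "state (12*y+5) (8*y+5) {b}" by simp
  have 6: "ones (12*y+6) = {8*y+5} \<and> state (12*y+6) (8*y+6) (insert b (ones (6*y+3)))"
    by (rule new_step_1[OF s5 f(6)]) auto
  show "ones (12*y+1) = {c, 4*y+1}" "ones (12*y+2) = {8*y+2}" "ones (12*y+3) = {8*y+3}"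
    "ones (12*y+4) = {8*y+4}" "ones (12*y+5) = {a, 4*y+2}" "ones (12*y+6) = {8*y+5}"
    "state (12*y+6) (8*y+6) (insert b (ones (6*y+3)))"
    using 1 2 3 4 5 6 by auto
  have "{1..5::nat} = {1, 2, 3, 4, 5}" by auto
  moreover have "\<not> ends_atom (12*y+1)" "\<not> ends_atom (12*y+2)" "\<not> ends_atom (12*y+3)"
      "\<not> ends_atom (12*y+4)" "\<not> ends_atom (12*y+5)"
    using state_ends_atom_iff[OF s1] state_ends_atom_iff[OF s2] state_ends_atom_iff[OF s3]
      state_ends_atom_iff[OF s4] state_ends_atom_iff[OF s5] ab ab_used[of "12*y+2"]
      ab_used[of "12*y+3"] by simp_all
  ultimately show "\<forall>i\<in>{1..5}. \<not> ends_atom (12*y+i)" by (simp only: ball_simps) simp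
qed

lemma block_second_half_regular:
  fixes y :: nat
  assumes s6: "state (12*y+6) (8*y+6) {2*y+1, 4*y+3}"
    and o3: "ones (6*y+3) = {4*y+3}" and o4: "ones (6*y+4) = {4*y+4}"
    and o5: "ones (6*y+5) = {h, 2*y+2}" "h < 2*y+2" and o6: "ones (6*y+6) = {4*y+5}"
  shows "ones (12*y+7) = {2*y+1, 4*y+3}" "ones (12*y+8) = {8*y+6}" "ones (12*y+9) = {8*y+7}"
    "ones (12*y+10) = {8*y+8}" "ones (12*y+11) = {h, 4*y+4}" "ones (12*y+12) = {8*y+9}"
    "state (12*y+12) (8*y+10) {2*y+2, 4*y+5}"
    "\<forall>i\<in>{6..12}. ends_atom (12*y+i) \<longleftrightarrow> i \<in> {6, 12}"
proof -
  have f: "freed (12*y+7) = {}" "freed (12*y+8) = {4*y+4}" "freed (12*y+9) = {}"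
    "freed (12*y+10) = {h, 2*y+2}" "freed (12*y+11) = {}" "freed (12*y+12) = {4*y+5}"
    using freed_even[of "12*y+8" "6*y+4"] freed_even[of "12*y+10" "6*y+5"]
      freed_even[of "12*y+12" "6*y+6"] o4 o5 o6 by (simp_all add: freed_odd)
  have 6: "{2*y+1, 4*y+3} \<notin> ones ` {..12*y+6}"
    using fresh_pair_unused[OF o3, of "12*y+6" "2*y+1"] by simp
  have 7: "ones (12*y+7) = {2*y+1, 4*y+3} \<and> state (12*y+7) (8*y+6) {}"
    by (rule pair_step_2[OF s6 6 f(1)]) simp
  then have s7: "state (12*y+7) (8*y+6) {}" by simp
  have 8: "ones (12*y+8) = {8*y+6} \<and> state (12*y+8) (8*y+7) {4*y+4}"
    by (rule new_step_0[OF s7 f(2)]) auto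
  then have s8: "state (12*y+8) (8*y+7) {4*y+4}" by simp
  have 9: "ones (12*y+9) = {8*y+7} \<and> state (12*y+9) (8*y+8) {4*y+4}"
    by (rule new_step_1[OF s8 f(3)]) auto
  then have s9: "state (12*y+9) (8*y+8) {4*y+4}" by simp
  have 10: "ones (12*y+10) = {8*y+8} \<and> state (12*y+10) (8*y+9) {h, 2*y+2, 4*y+4}"
    by (rule new_step_1[OF s9 f(4)]) auto
  then have s10: "state (12*y+10) (8*y+9) {h, 2*y+2, 4*y+4}" by simp
  \<comment> \<open>Freshness of 4y+4 reaches only to twice 6y+4; the two remaining terms are new
    singletons.\<close>
  have "{h, 4*y+4} \<notin> ones ` {..12*y+8}"
    using fresh_pair_unused[OF o4, of "12*y+8" h] o5(2) by simp
  moreover have "ones (12*y+9) \<noteq> {h, 4*y+4}" "ones (12*y+10) \<noteq> {h, 4*y+4}"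
    using 9 10 o5(2) by (auto simp: doubleton_eq_iff)
  moreover have "{..12*y+10} = {..12*y+8} \<union> {12*y+9, 12*y+10}" by auto
  ultimately have unused: "{h, 4*y+4} \<notin> ones ` {..12*y+10}" by (simp only: image_Un) auto
  have 11: "ones (12*y+11) = {h, 4*y+4} \<and> state (12*y+11) (8*y+9) {2*y+2}"
    by (rule pair_step_3[OF s10 refl _ _ _ _ _ _ f(5)])
      (use o5(2) used_image[OF o5(1)] unused in auto)
  then have s11: "state (12*y+11) (8*y+9) {2*y+2}" by simp
  have 12: "ones (12*y+12) = {8*y+9} \<and> state (12*y+12) (8*y+10) {2*y+2, 4*y+5}"
    by (rule new_step_1[OF s11 f(6)]) auto
  then have s12: "state (12*y+12) (8*y+10) {2*y+2, 4*y+5}" by simp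
  show "ones (12*y+7) = {2*y+1, 4*y+3}" "ones (12*y+8) = {8*y+6}" "ones (12*y+9) = {8*y+7}"
    "ones (12*y+10) = {8*y+8}" "ones (12*y+11) = {h, 4*y+4}" "ones (12*y+12) = {8*y+9}"
    "state (12*y+12) (8*y+10) {2*y+2, 4*y+5}"
    using 7 8 9 10 11 12 by auto
  have "{6..12::nat} = {6, 7, 8, 9, 10, 11, 12}" by auto
  moreover have "ends_atom (12*y+6)" "\<not> ends_atom (12*y+7)" "\<not> ends_atom (12*y+8)"
      "\<not> ends_atom (12*y+9)" "\<not> ends_atom (12*y+10)" "\<not> ends_atom (12*y+11)" "ends_atom (12*y+12)"
    using state_ends_atom_iff[OF s6] state_ends_atom_iff[OF s7] state_ends_atom_iff[OF s8]
      state_ends_atom_iff[OF s9] state_ends_atom_iff[OF s10] state_ends_atom_iff[OF s11]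
      state_ends_atom_iff[OF s12] 6 o5(2) fresh_pair_unused[OF o6, of "12*y+12" "2*y+2"] by simp_all
  ultimately show "\<forall>i\<in>{6..12}. ends_atom (12*y+i) \<longleftrightarrow> i \<in> {6, 12}" by (simp only: ball_simps) simp
qed

text \<open>Here a pair is freed at 12y+6, so three exponents are free and no atom ends there. Two
  of their pairs are used, which forces the third; then \<open>q\<close> remains, and with the freed
  4y+3 it ends the atom two terms later.\<close>

lemma block_second_half_exceptional:
  fixes y :: nat
  assumes s6: "state (12*y+6) (8*y+6) {s, q, 2*y+1}" and sq: "s \<noteq> q" "s < 2*y+1" "q < 2*y+1"
    and used: "{s, q} \<in> ones ` {..12*y+6}" "{q, 2*y+1} \<in> ones ` {..12*y+6}"
    and unused: "{s, 2*y+1} \<notin> ones ` {..12*y+6}"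
    and o4: "ones (6*y+4) = {4*y+3}" and o5: "ones (6*y+5) = {4*y+4}" and o6: "ones (6*y+6) = {4*y+5}"
  shows "ones (12*y+7) = {s, 2*y+1}" "ones (12*y+8) = {8*y+6}" "ones (12*y+9) = {q, 4*y+3}"
    "ones (12*y+10) = {8*y+7}" "ones (12*y+11) = {8*y+8}" "ones (12*y+12) = {8*y+9}"
    "state (12*y+12) (8*y+10) {4*y+4, 4*y+5}"
    "\<forall>i\<in>{6..12}. ends_atom (12*y+i) \<longleftrightarrow> i \<in> {8, 12}"
proof -
  have f: "freed (12*y+7) = {}" "freed (12*y+8) = {4*y+3}" "freed (12*y+9) = {}"
    "freed (12*y+10) = {4*y+4}" "freed (12*y+11) = {}" "freed (12*y+12) = {4*y+5}"
    using freed_even[of "12*y+8" "6*y+4"] freed_even[of "12*y+10" "6*y+5"]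
      freed_even[of "12*y+12" "6*y+6"] o4 o5 o6 by (simp_all add: freed_odd)
  have 7: "ones (12*y+7) = {s, 2*y+1} \<and> state (12*y+7) (8*y+6) {q}"
    by (rule pair_step_3[OF s6 refl _ _ _ _ _ _ f(1)]) (use sq used unused in auto)
  then have s7: "state (12*y+7) (8*y+6) {q}" by simp
  have 8: "ones (12*y+8) = {8*y+6} \<and> state (12*y+8) (8*y+7) {q, 4*y+3}"
    by (rule new_step_1[OF s7 f(2)]) auto
  then have s8: "state (12*y+8) (8*y+7) {q, 4*y+3}" by simp
  have u8: "{q, 4*y+3} \<notin> ones ` {..12*y+8}"
    using fresh_pair_unused[OF o4, of "12*y+8" q] sq(3) by simp
  have 9: "ones (12*y+9) = {q, 4*y+3} \<and> state (12*y+9) (8*y+7) {}"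
    by (rule pair_step_2[OF s8 u8 f(3)]) simp
  then have s9: "state (12*y+9) (8*y+7) {}" by simp
  have 10: "ones (12*y+10) = {8*y+7} \<and> state (12*y+10) (8*y+8) {4*y+4}"
    by (rule new_step_0[OF s9 f(4)]) auto
  then have s10: "state (12*y+10) (8*y+8) {4*y+4}" by simp
  have 11: "ones (12*y+11) = {8*y+8} \<and> state (12*y+11) (8*y+9) {4*y+4}"
    by (rule new_step_1[OF s10 f(5)]) auto
  then have s11: "state (12*y+11) (8*y+9) {4*y+4}" by simp
  have 12: "ones (12*y+12) = {8*y+9} \<and> state (12*y+12) (8*y+10) {4*y+4, 4*y+5}"
    by (rule new_step_1[OF s11 f(6)]) auto
  then have s12: "state (12*y+12) (8*y+10) {4*y+4, 4*y+5}" by simp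
  show "ones (12*y+7) = {s, 2*y+1}" "ones (12*y+8) = {8*y+6}" "ones (12*y+9) = {q, 4*y+3}"
    "ones (12*y+10) = {8*y+7}" "ones (12*y+11) = {8*y+8}" "ones (12*y+12) = {8*y+9}"
    "state (12*y+12) (8*y+10) {4*y+4, 4*y+5}"
    using 7 8 9 10 11 12 by auto
  have "{6..12::nat} = {6, 7, 8, 9, 10, 11, 12}" by auto
  moreover have "\<not> ends_atom (12*y+6)" "\<not> ends_atom (12*y+7)" "ends_atom (12*y+8)"
      "\<not> ends_atom (12*y+9)" "\<not> ends_atom (12*y+10)" "\<not> ends_atom (12*y+11)" "ends_atom (12*y+12)"
    using state_ends_atom_iff[OF s6] state_ends_atom_iff[OF s7] state_ends_atom_iff[OF s8]
      state_ends_atom_iff[OF s9] state_ends_atom_iff[OF s10] state_ends_atom_iff[OF s11]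
      state_ends_atom_iff[OF s12] u8 sq fresh_pair_unused[OF o6, of "12*y+12" "4*y+4"] by simp_all
  ultimately show "\<forall>i\<in>{6..12}. ends_atom (12*y+i) \<longleftrightarrow> i \<in> {8, 12}" by (simp only: ball_simps) simp
qed

section \<open>Induction over the blocks\<close>

definition mu_set :: "nat set" where
  "mu_set = {2 ^ i |i. True} \<union> {3 * 2 ^ i |i. True}"

lemma mu_set_double_iff:
  assumes "y \<ge> 2"
  shows "2 * y \<in> mu_set \<longleftrightarrow> y \<in> mu_set"
proof
  assume "y \<in> mu_set"
  then show "2 * y \<in> mu_set"
    unfolding mu_set_def by (auto simp flip: power_Suc simp: mult.left_commute[of 2])
next
  assume "2 * y \<in> mu_set"
  then consider i where "2 * y = 2 ^ i" | i where "2 * y = 3 * 2 ^ i"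
    unfolding mu_set_def by auto
  then show "y \<in> mu_set"
  proof cases
    case 1
    then show ?thesis using assms by (cases i) (auto simp: mu_set_def)
  next
    case 2
    then have "i \<noteq> 0" by (intro notI) (simp, presburger)
    then obtain i' where "i = Suc i'" by (cases i) auto
    then show ?thesis using 2 by (auto simp: mu_set_def)
  qed
qed

lemma odd_not_in_mu_set:
  assumes "odd y" "y > 3"
  shows "y \<notin> mu_set"
proof
  assume "y \<in> mu_set"
  then obtain i where "y = 2 ^ i \<or> y = 3 * 2 ^ i" by (auto simp: mu_set_def)
  with assms show False by (cases i) auto
qed

text \<open>The exponent that opens block \<open>y\<close> beside 4y+1. A regular block
  \<open>y - 1\<close> leaves 2(y-1)+2 = 2y, an exceptional one 4(y-1)+4 = 4y, and it is exceptional
  exactly when \<open>y\<close> is in \<open>mu_set\<close>.\<close>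

definition lead :: "nat \<Rightarrow> nat" where
  "lead y = (if y \<in> mu_set then 4 * y else 2 * y)"

definition regular_block :: "nat \<Rightarrow> bool" where
  "regular_block y \<longleftrightarrow> ones (6*y+1) = {lead y div 2, 2*y+1} \<and> ones (6*y+2) = {4*y+2} \<and>
     ones (6*y+3) = {4*y+3} \<and> ones (6*y+4) = {4*y+4} \<and>
     ones (12*y+5) = {lead y div 2, 4*y+2} \<and> ones (12*y+7) = {2*y+1, 4*y+3} \<and>
     ones (12*y+9) = {8*y+7} \<and> ones (12*y+10) = {8*y+8} \<and>
     (\<exists>g<2*y+2. ones (12*y+11) = {g, 4*y+4})"

text \<open>These second-half terms are freed in block 2y+1, again exceptional. That
  \<open>{s, q}\<close> is used prevents its choice there.\<close>

definition exceptional_block :: "nat \<Rightarrow> bool" where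
  "exceptional_block y \<longleftrightarrow> ones (6*y+4) = {4*y+3} \<and> ones (12*y+10) = {8*y+7} \<and> ones (12*y+11) = {8*y+8} \<and>
     (\<exists>r s q. ones (12*y+7) = {r, s} \<and> ones (12*y+9) = {q, 4*y+3} \<and>
        r < s \<and> s \<le> 2*y+1 \<and> q \<noteq> s \<and> q < 4*y+3 \<and> {s, q} \<in> ones ` {..12*y+8})"

lemma exceptional_blockI:
  assumes "ones (6*y+4) = {4*y+3}" "ones (12*y+10) = {8*y+7}" "ones (12*y+11) = {8*y+8}"
    "ones (12*y+7) = {r, s}" "ones (12*y+9) = {q, 4*y+3}"
    "r < s" "s \<le> 2*y+1" "q \<noteq> s" "q < 4*y+3" "{s, q} \<in> ones ` {..12*y+8}"
  shows "exceptional_block y"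
  unfolding exceptional_block_def using assms by blast

text \<open>The first half is what block 2y frees, the second what block 2y+1 frees; only the second
  depends on the kind of block.\<close>

definition block :: "nat \<Rightarrow> bool" where
  "block y \<longleftrightarrow> ones (12*y) = {8*y+1} \<and> ones (12*y+1) = {lead y, 4*y+1} \<and>
     ones (12*y+2) = {8*y+2} \<and> ones (12*y+3) = {8*y+3} \<and> ones (12*y+4) = {8*y+4} \<and>
     (\<exists>h<4*y+2. ones (12*y+5) = {h, 4*y+2}) \<and> ones (12*y+6) = {8*y+5} \<and>
     ones (12*y+8) = {8*y+6} \<and> ones (12*y+12) = {8*y+9} \<and>
     (\<forall>i\<in>{1..12}. ends_atom (12*y+i) \<longleftrightarrow> i \<in> {if Suc y \<in> mu_set then 8 else 6, 12}) \<and>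
     (if Suc y \<in> mu_set then exceptional_block y else regular_block y)"

lemma twelve_cases: "{1..12::nat} = {1..5} \<union> {6..12}"
  by auto

text \<open>Even \<open>y\<close> frees the first half of block y/2, whatever its kind. Odd
  \<open>y\<close> frees the second half of block (y-1)/2, which is regular because halving y+1
  preserves membership in \<open>mu_set\<close>.\<close>

lemma block_step_regular:
  assumes y: "y \<ge> 8" "Suc y \<notin> mu_set" and z: "block (y div 2)"
    and st: "state (12*y) (8*y+2) {lead y, 4*y+1}" and o: "ones (12*y) = {8*y+1}"
  shows "block y \<and> state (12*Suc y) (8*Suc y+2) {lead (Suc y), 4*Suc y+1}"
proof -
  define z where "z = y div 2"
  have zb: "block z" using z by (simp add: z_def)
  have prev: "ones (6*y) = {4*y+1} \<and> ones (6*y+1) = {lead y div 2, 2*y+1} \<and> ones (6*y+2) = {4*y+2} \<and>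
    ones (6*y+3) = {4*y+3} \<and> ones (6*y+4) = {4*y+4} \<and> (\<exists>h<2*y+2. ones (6*y+5) = {h, 2*y+2}) \<and>
    ones (6*y+6) = {4*y+5}"
  proof (cases "even y")
    case True
    then have yz: "y = 2 * z" by (simp add: z_def)
    have "lead y div 2 = lead z"
      using mu_set_double_iff[of z] y yz by (simp add: lead_def)
    then show ?thesis
      using zb by (auto simp: block_def yz)
  next
    case False
    then have yz: "y = 2 * z + 1" by (simp add: z_def)
    have "Suc z \<notin> mu_set"
      using mu_set_double_iff[of "Suc z"] y yz by simp
    then have "regular_block z" using zb by (simp add: block_def)
    moreover have "lead y div 2 = y"
      using odd_not_in_mu_set[of y] False y by (simp add: lead_def)
    moreover have "\<exists>h<2*y+2. ones (6*y+5) = {h, 2*y+2}"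
    proof -
      obtain g where g: "g < 2*z+2" "ones (12*z+11) = {g, 4*z+4}"
        using \<open>regular_block z\<close> unfolding regular_block_def by blast
      have eqs: "12*z+11 = 6*y+5" "4*z+4 = 2*y+2" using yz by simp_all
      have "ones (6*y+5) = {g, 2*y+2}" using g(2) unfolding eqs .
      moreover have "g < 2*y+2" using g(1) yz by simp
      ultimately show ?thesis by blast
    qed
    ultimately show ?thesis
      using zb by (simp add: block_def regular_block_def yz add.commute numeral_3_eq_3)
  qed
  then obtain h where h: "h < 2*y+2" "ones (6*y+5) = {h, 2*y+2}" by auto
  have ab: "lead y div 2 < 2*y+1" "2*y+1 < 4*y+2" "lead y \<noteq> 4*y+1"
    using y by (auto simp: lead_def)
  note first = block_first_half[OF _ st ab(3) _ _ ab(1,2)]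
  have s6: "state (12*y+6) (8*y+6) {2*y+1, 4*y+3}"
    using first(7) prev y by simp
  have second: "ones (12*y+7) = {2*y+1, 4*y+3}" "ones (12*y+8) = {8*y+6}" "ones (12*y+9) = {8*y+7}"
    "ones (12*y+10) = {8*y+8}" "ones (12*y+11) = {h, 4*y+4}" "ones (12*y+12) = {8*y+9}"
    "state (12*y+12) (8*y+10) {2*y+2, 4*y+5}"
    "\<forall>i\<in>{6..12}. ends_atom (12*y+i) \<longleftrightarrow> i \<in> {6, 12}"
    using block_second_half_regular[OF s6 _ _ h(2,1)] prev by auto
  have "\<exists>h<4*y+2. ones (12*y+5) = {h, 4*y+2}"
    using first(5) prev y ab by (intro exI[of _ "lead y div 2"]) auto
  moreover have "\<forall>i\<in>{1..12}. ends_atom (12*y+i) \<longleftrightarrow> i \<in> {6, 12}"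
    using first(8) prev y second(8) unfolding twelve_cases by auto
  moreover have "regular_block y"
    using first prev y second h by (auto simp: regular_block_def)
  ultimately have "block y"
    using first prev y second o by (simp add: block_def)
  moreover have "lead (Suc y) = 2*y+2"
    using y by (simp add: lead_def)
  ultimately show ?thesis
    using second(7) by (simp add: algebra_simps)
qed

lemma block_step_exceptional:
  assumes y: "y \<ge> 8" "Suc y \<in> mu_set" and z: "block (y div 2)"
    and st: "state (12*y) (8*y+2) {lead y, 4*y+1}" and o: "ones (12*y) = {8*y+1}"
  shows "block y \<and> state (12*Suc y) (8*Suc y+2) {lead (Suc y), 4*Suc y+1}"
proof -
  define z where "z = y div 2"
  have zb: "block z" using z by (simp add: z_def)
  \<comment> \<open>Members of \<open>mu_set\<close> above 3 are even, so an exceptional block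
    always descends from the second half of an exceptional block.\<close>
  have "odd y" using odd_not_in_mu_set[of "Suc y"] y by auto
  then have yz: "y = 2 * z + 1" by (simp add: z_def)
  have sz: "Suc z \<in> mu_set"
    using mu_set_double_iff[of "Suc z"] y yz by simp
  then have ez: "exceptional_block z" using zb by (simp add: block_def)
  then obtain r s q where rsq: "ones (12*z+7) = {r, s}" "ones (12*z+9) = {q, 4*z+3}"
    "r < s" "s \<le> 2*z+1" "q \<noteq> s" "q < 4*z+3" "{s, q} \<in> ones ` {..12*z+8}"
    by (auto simp: exceptional_block_def)
  have prev: "ones (6*y) = {4*y+1}" "ones (6*y+1) = {r, s}" "ones (6*y+2) = {4*y+2}"
    "ones (6*y+4) = {4*y+3}" "ones (6*y+5) = {4*y+4}" "ones (6*y+6) = {4*y+5}"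
    using zb ez rsq by (simp_all add: block_def exceptional_block_def yz add.commute)
  have eqs: "12*z+9 = 6*y+3" "4*z+3 = 2*y+1" using yz by simp_all
  have prev_pair: "ones (6*y+3) = {q, 2*y+1}"
    using rsq(2) unfolding eqs .
  have bnd: "s < 4*y+2" "lead y \<noteq> 4*y+1" "s \<noteq> q" "s < 2*y+1" "q < 2*y+1"
    using y rsq yz by (auto simp: lead_def)
  note first = block_first_half[OF _ st bnd(2) prev(1,2) rsq(3) bnd(1) prev(3)]
  have s6: "state (12*y+6) (8*y+6) {s, q, 2*y+1}"
    using first(7) prev_pair y by simp
  have used1: "{s, q} \<in> ones ` {..12*y+6}"
    using rsq(7) yz by (auto intro: image_mono[THEN subsetD, rotated])
  have used2: "{q, 2*y+1} \<in> ones ` {..n}" if "n \<ge> 6*y+3" for n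
    using used_image[OF prev_pair] that by simp
  (* The exponent 2y+1 occurs only in its singleton and in the pair at 6y+3: before that pair it
     is not yet free a second time, and after it it stays blocked up to position 12y+6. *)
  have "ones i \<noteq> {s, 2*y+1}" if i: "i \<le> 12*y+6" for i
  proof
    assume eq: "ones i = {s, 2*y+1}"
    have "ones (6*z+4) = {2*y+1}"
      using ez by (simp add: exceptional_block_def yz)
    from ones_singleton_fresh[OF this, of i] have "\<not> i \<le> 12*z+8"
      using eq bnd by auto
    then consider "i = 6*y+3" | "6*y+3 < i" using yz by linarith
    then show False
    proof cases
      case 1
      then show ?thesis using eq prev_pair bnd by (auto simp: doubleton_eq_iff)
    next
      case 2
      then show ?thesis using ones_disjoint[of "6*y+3" i] i eq prev_pair by auto
    qed
  qed
  then have unused: "{s, 2*y+1} \<notin> ones ` {..12*y+6}" by auto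
  note second = block_second_half_exceptional[OF s6 bnd(3-5) used1 used2 unused prev(4-6)]
  have "\<exists>h<4*y+2. ones (12*y+5) = {h, 4*y+2}"
    using first(5) y rsq bnd by (intro exI[of _ r]) auto
  moreover have "\<forall>i\<in>{1..12}. ends_atom (12*y+i) \<longleftrightarrow> i \<in> {8, 12}"
    using first(8) y second(8) unfolding twelve_cases by auto
  \<comment> \<open>The data move on: \<open>s\<close> takes the role of \<open>r\<close>, 2y+1 that
    of \<open>s\<close>, and \<open>q\<close> stays. The pair of 2y+1 and \<open>q\<close> was used
    at 6y+3.\<close>
  moreover have "exceptional_block y"
    by (rule exceptional_blockI[OF prev(4) second(4,5,1,3)])
      (use bnd used2[of "12*y+8"] in \<open>simp_all add: insert_commute\<close>)
  ultimately have "block y"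
    using first prev y second o by (simp add: block_def)
  moreover have "lead (Suc y) = 4*y+4"
    using y by (simp add: lead_def)
  ultimately show ?thesis
    using second(7) by (simp add: algebra_simps)
qed

lemma in_mu_set_small: "4 \<in> mu_set" "5 \<notin> mu_set" "6 \<in> mu_set" "7 \<notin> mu_set" "8 \<in> mu_set"
proof -
  have "(2::nat) ^ 2 \<in> mu_set" "3 * (2::nat) ^ 1 \<in> mu_set" "(2::nat) ^ 3 \<in> mu_set"
    unfolding mu_set_def by blast+
  then show "4 \<in> mu_set" "6 \<in> mu_set" "8 \<in> mu_set" by simp_all
qed (simp_all add: odd_not_in_mu_set)

lemmas initial_values = initial_terms_def
  initial_ones[of "numeral k" for k, unfolded initial_terms_def]

lemma initial_blocks: "block 4" "block 5" "block 6" "block 7"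
proof -
  note defs = block_def lead_def regular_block_def exceptional_block_def in_mu_set_small
    initial_values doubleton_eq_iff
  have ends: "\<forall>i\<in>{1..12}. ends_atom (48+i) \<longleftrightarrow> i \<in> {6, 12}" "\<forall>i\<in>{1..12}. ends_atom (60+i) \<longleftrightarrow> i \<in> {8, 12}"
     "\<forall>i\<in>{1..12}. ends_atom (72+i) \<longleftrightarrow> i \<in> {6, 12}" "\<forall>i\<in>{1..12}. ends_atom (84+i) \<longleftrightarrow> i \<in> {8, 12}"
    by (auto simp: initial_ends)
  show "block 4"
    using ends(1) by (simp add: defs)
  show "block 6"
    using ends(3) by (simp add: defs)
  \<comment> \<open>These are the used pairs \<open>{s, q}\<close> required for the exceptional
    blocks 5 and 7.\<close>
  have "ones 33 = {5, 11}" "ones 45 = {7, 15}"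
    by (auto simp: initial_values)
  note used = this[THEN used_image]
  have "exceptional_block 5"
    by (rule exceptional_blockI[where r = 4 and s = 5 and q = 11])
      (use used(1)[of 68] in \<open>simp_all add: initial_values doubleton_eq_iff\<close>)
  then show "block 5"
    using ends(2) by (simp add: block_def lead_def in_mu_set_small initial_values doubleton_eq_iff)
  have "exceptional_block 7"
    by (rule exceptional_blockI[where r = 6 and s = 7 and q = 15])
      (use used(2)[of 92] in \<open>simp_all add: initial_values doubleton_eq_iff\<close>)
  then show "block 7"
    using ends(4) by (simp add: block_def lead_def in_mu_set_small initial_values doubleton_eq_iff)
qed

text \<open>The induction starts at 8 so that \<open>y div 2\<close> is at least 4, a block already
  treated.\<close>

lemma block_and_state:
  assumes "y \<ge> 8"
  shows "(\<forall>z\<in>{4..<y}. block z) \<and> state (12*y) (8*y+2) {lead y, 4*y+1} \<and> ones (12*y) = {8*y+1}"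
  using assms
proof (induction y rule: dec_induct)
  case base
  have "{4..<8::nat} = {4, 5, 6, 7}" by auto
  then show ?case
    using initial_blocks initial_history(2) in_mu_set_small
    by (simp add: lead_def initial_values)
next
  case (step y)
  then have "y div 2 \<in> {4..<y}" by auto
  with step have "block y \<and> state (12*Suc y) (8*Suc y+2) {lead (Suc y), 4*Suc y+1}"
    using block_step_regular[of y] block_step_exceptional[of y] by blast
  moreover from this have "ones (12*Suc y) = {8*Suc y+1}"
    by (simp add: block_def add.commute)
  ultimately show ?case
    using step by (auto simp: less_Suc_eq)
qed

lemma block: "y \<ge> 4 \<Longrightarrow> block y"
  using block_and_state[of "Suc y + 4"] by auto

section \<open>Labels of the atoms of type V\<close>

lemma infinite_mu_set: "infinite mu_set"
proof -
  have "range (\<lambda>i. (2::nat) ^ i) \<subseteq> mu_set" by (auto simp: mu_set_def)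
  moreover have "infinite (range (\<lambda>i. (2::nat) ^ i))"
    by (rule range_inj_infinite) (auto simp: inj_def)
  ultimately show ?thesis by (rule infinite_super)
qed

text \<open>Powers of two and their triples alternate; comparing exponents leaves no room for a
  further element in between.\<close>

lemma next_in_mu_set:
  "enumerate mu_set n = 2 ^ Suc i \<Longrightarrow> enumerate mu_set (Suc n) = 3 * 2 ^ i"
  "enumerate mu_set n = 3 * 2 ^ i \<Longrightarrow> enumerate mu_set (Suc n) = 2 ^ (i + 2)"
proof -
  have le1: "3 * 2 ^ i \<le> s" if "s \<in> mu_set" "2 ^ Suc i < s" for s
  proof -
    from that consider j where "s = 2 ^ j" | j where "s = 3 * 2 ^ j" by (auto simp: mu_set_def)
    then show ?thesis
    proof cases
      case 1
      then have "(2::nat) ^ Suc i < 2 ^ j" using that by simp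
      then have "Suc i < j" by (rule power_less_imp_less_exp[rotated]) simp
      then have "(2::nat) ^ (i + 2) \<le> 2 ^ j" by (intro power_increasing) auto
      then show ?thesis using 1 by simp
    next
      case 2
      have "\<not> j < i"
      proof
        assume "j < i"
        then have "(2::nat) ^ Suc j \<le> 2 ^ i" by (intro power_increasing) auto
        then show False using that 2 by simp
      qed
      then have "(2::nat) ^ i \<le> 2 ^ j" by simp
      then show ?thesis using 2 by simp
    qed
  qed
  have le2: "2 ^ (i + 2) \<le> s" if "s \<in> mu_set" "3 * 2 ^ i < s" for s
  proof -
    from that consider j where "s = 2 ^ j" | j where "s = 3 * 2 ^ j" by (auto simp: mu_set_def)
    then show ?thesis
    proof cases
      case 1
      have "\<not> j < i + 2"
      proof
        assume "j < i + 2"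
        then have "(2::nat) ^ j \<le> 2 ^ Suc i" by (intro power_increasing) auto
        then show False using that 1 by simp
      qed
      then show ?thesis using 1 by (simp add: power_increasing del: power_Suc)
    next
      case 2
      then have "i < j" using that power_strict_increasing_iff[of "2::nat"] by simp
      then have "(2::nat) ^ Suc i \<le> 2 ^ j" by (intro power_increasing) auto
      then show ?thesis using 2 by simp
    qed
  qed
  have "3 * 2 ^ i \<in> mu_set" "2 ^ (i + 2) \<in> mu_set"
    unfolding mu_set_def by blast+
  then show "enumerate mu_set n = 2 ^ Suc i \<Longrightarrow> enumerate mu_set (Suc n) = 3 * 2 ^ i"
    "enumerate mu_set n = 3 * 2 ^ i \<Longrightarrow> enumerate mu_set (Suc n) = 2 ^ (i + 2)"
    using le1 le2 by (auto simp: enumerate_Suc''[OF infinite_mu_set] intro!: Least_equality)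
qed

lemma enumerate_mu_set:
  "enumerate mu_set (2 * i + 1) = 2 ^ Suc i \<and> enumerate mu_set (2 * i + 2) = 3 * 2 ^ i"
proof (induction i)
  case 0
  have one: "1 \<in> mu_set" and two: "2 \<in> mu_set"
    by (auto simp: mu_set_def intro: exI[of _ 0] exI[of _ 1])
  have pos: "s \<ge> 1" if "s \<in> mu_set" for s
    using that by (auto simp: mu_set_def)
  have "enumerate mu_set 0 = 1"
    unfolding enumerate_0 using one pos by (intro Least_equality)
  then have "enumerate mu_set (Suc 0) = 2"
    unfolding enumerate_Suc''[OF infinite_mu_set] using two by (intro Least_equality) auto
  then show ?case
    using next_in_mu_set(1)[of 1 0] by simp
next
  case (Suc i)
  then have "enumerate mu_set (2 * Suc i + 1) = 2 ^ Suc (Suc i)"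
    using next_in_mu_set(2)[of "2 * i + 2" i] by simp
  then show ?case
    using next_in_mu_set(1)[of "2 * Suc i + 1" "Suc i"] by simp
qed

lemma mu_eq: "mu (k + 4) = enumerate mu_set (k + 3)"
proof -
  have "k + 4 - 1 = k + 3" by simp
  then show ?thesis unfolding mu_def mu_set_def by (simp only:)
qed

lemma mu_even: "mu (2 * i + 4) = 2 ^ (i + 2)"
proof -
  have idx: "2 * i + 3 = 2 * (i + 1) + 1" by simp
  show ?thesis
    unfolding mu_eq idx using enumerate_mu_set[of "i + 1"] by simp
qed

lemma mu_odd: "mu (2 * i + 5) = 3 * 2 ^ (i + 1)"
proof -
  have "2 * i + 5 = (2 * i + 1) + 4" "2 * i + 1 + 3 = 2 * (i + 1) + 2" by simp_all
  then show ?thesis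
    using enumerate_mu_set[of "i + 1"] mu_eq[of "2 * i + 1"] by (simp only:)
qed

lemma mu_Suc: "mu (Suc k + 4) = mu (k + 4) + 2 ^ (k div 2 + 1)"
proof (cases "even k")
  case True
  then obtain i where "k = 2 * i" by auto
  then have idx: "k + 4 = 2 * i + 4" "Suc k + 4 = 2 * i + 5" "k div 2 = i" by simp_all
  show ?thesis
    unfolding idx using mu_even[of i] mu_odd[of i] by simp
next
  case False
  then obtain i where "k = 2 * i + 1" by (elim oddE)
  then have idx: "k + 4 = 2 * i + 5" "Suc k + 4 = 2 * Suc i + 4" "k div 2 = i" by simp_all
  show ?thesis
    unfolding idx using mu_even[of "Suc i"] mu_odd[of i] by simp
qed

lemma mu_4: "mu (0 + 4) = 4"
  using mu_even[of 0] by simp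

lemma mu_mono: "k \<le> l \<Longrightarrow> mu (k + 4) \<le> mu (l + 4)"
  unfolding mu_eq using infinite_mu_set by simp

lemma mu_ge_4: "mu (k + 4) \<ge> 4"
  using mu_mono[of 0 k] mu_4 by simp

lemma mu_in_mu_set: "mu (k + 4) \<in> mu_set"
  unfolding mu_eq by (rule enumerate_in_set[OF infinite_mu_set])

lemma not_in_mu_set:
  assumes "mu (k + 4) < s" "s < mu (Suc k + 4)"
  shows "s \<notin> mu_set"
proof
  assume "s \<in> mu_set"
  then obtain n where "enumerate mu_set n = s"
    using enumerate_Ex[OF infinite_mu_set] by blast
  with assms have "k + 3 < n" "n < Suc k + 3"
    unfolding mu_eq using infinite_mu_set by auto
  then show False by simp
qed

text \<open>The gap to the next value of \<open>mu\<close> is 2^(k div 2 + 1). The labels fill it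
  except for its last number, which is the exceptional block.\<close>

lemma V_label_iff: "V_label k j \<longleftrightarrow> mu (k + 4) + j + 1 < mu (Suc k + 4)"
proof -
  have "(2::nat) ^ (k div 2 + 1) \<ge> 2" by simp
  then show ?thesis unfolding mu_Suc V_label_def by linarith
qed

lemma V_label_mono:
  assumes "V_label k' j'" "k' < k \<or> k' = k \<and> j' < j"
  shows "mu (k' + 4) + j' < mu (k + 4) + j"
  using assms mu_mono[of "Suc k'" k] unfolding V_label_iff by auto

lemma ex_V_label:
  assumes "y \<ge> 4" "Suc y \<notin> mu_set"
  obtains k j where "V_label k j" "y = mu (k + 4) + j"
proof -
  \<comment> \<open>The last value of \<open>mu\<close> not above \<open>y\<close>; the maximum
    exists because \<open>mu (k + 4)\<close> is at least \<open>k\<close>.\<close>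
  define k where "k = Max {k. mu (k + 4) \<le> y}"
  have "k \<le> mu (k + 4)" for k
    unfolding mu_eq using le_enumerate[OF infinite_mu_set, of "k + 3"] by simp
  then have "{k. mu (k + 4) \<le> y} \<subseteq> {..y}"
    using le_trans by blast
  then have fin: "finite {k. mu (k + 4) \<le> y}"
    by (rule finite_subset) simp
  moreover have "0 \<in> {k. mu (k + 4) \<le> y}" using assms mu_4 by simp
  ultimately have k: "mu (k + 4) \<le> y"
    unfolding k_def using Max_in[of "{k. mu (k + 4) \<le> y}"] by blast
  have "\<not> mu (Suc k + 4) \<le> y"
    using Max_ge[OF fin, of "Suc k"] by (auto simp: k_def)
  moreover have "mu (Suc k + 4) \<noteq> Suc y"
    using assms(2) mu_in_mu_set[of "Suc k"] by metis
  ultimately have "V_label k (y - mu (k + 4))"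
    using k unfolding V_label_iff by linarith
  then show ?thesis using that[of k "y - mu (k + 4)"] k by simp
qed

lemma V_label_regular:
  assumes "V_label k j"
  shows "Suc (mu (k + 4) + j) \<notin> mu_set"
  using assms not_in_mu_set[of k "Suc (mu (k + 4) + j)"] by (simp add: V_label_iff)

text \<open>The map from (k, j) to \<open>mu (k + 4) + j\<close> is strictly increasing in
  lexicographic order and hits exactly the regular blocks, so ranks can be counted there.\<close>

lemma V_label_rank_eq:
  assumes "V_label k j"
  shows "V_label_rank k j = card {y. 4 \<le> y \<and> y < mu (k + 4) + j \<and> Suc y \<notin> mu_set}"
proof -
  define L where "L = {(k', j'). V_label k' j' \<and> (k' < k \<or> k' = k \<and> j' < j)}"
  define f where "f = (\<lambda>(k', j'). mu (k' + 4) + j')"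
  have "inj_on f L"
  proof (rule inj_onI)
    fix p q assume pq: "p \<in> L" "q \<in> L" "f p = f q"
    obtain a b c d where "p = (a, b)" "q = (c, d)" by (cases p, cases q)
    then show "p = q"
      using pq V_label_mono[of a b c d] V_label_mono[of c d a b]
      by (auto simp: L_def f_def) (metis nat_neq_iff)+
  qed
  moreover have "f ` L = {y. 4 \<le> y \<and> y < mu (k + 4) + j \<and> Suc y \<notin> mu_set}"
  proof (intro equalityI subsetI)
    fix y assume "y \<in> f ` L"
    then obtain a b where ab: "(a, b) \<in> L" "y = mu (a + 4) + b" by (auto simp: f_def)
    then show "y \<in> {y. 4 \<le> y \<and> y < mu (k + 4) + j \<and> Suc y \<notin> mu_set}"
      using V_label_mono[of a b k j] V_label_regular[of a b] mu_ge_4[of a] by (auto simp: L_def)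
  next
    fix y assume y: "y \<in> {y. 4 \<le> y \<and> y < mu (k + 4) + j \<and> Suc y \<notin> mu_set}"
    then obtain a b where ab: "V_label a b" "y = mu (a + 4) + b" using ex_V_label by blast
    have "\<not> (k < a \<or> k = a \<and> j < b)" "\<not> (a = k \<and> b = j)"
      using V_label_mono[OF assms, of a b] ab y by auto
    then have "a < k \<or> a = k \<and> b < j"
      by (metis nat_neq_iff)
    then show "y \<in> f ` L" using ab by (force simp: L_def f_def)
  qed
  ultimately show ?thesis
    unfolding V_label_rank_def L_def[symmetric] by (metis card_image)
qed

section \<open>Classification of the atoms of type V\<close>

lemma ends_atom_block:
  assumes "y \<ge> 4" "i \<in> {1..12}"
  shows "ends_atom (12*y+i) \<longleftrightarrow> i \<in> {if Suc y \<in> mu_set then 8 else 6, 12}"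
  using block[OF assms(1)] assms(2) unfolding block_def by blast

lemma ends_atom_twelve: "y \<ge> 4 \<Longrightarrow> ends_atom (12*y)"
proof -
  assume y: "y \<ge> 4"
  show "ends_atom (12*y)"
  proof (cases "y = 4")
    case False
    then have "12*y = 12*(y-1)+12" "y - 1 \<ge> 4" using y by auto
    then show ?thesis using ends_atom_block[of "y-1" 12] by simp
  qed (simp add: initial_ends)
qed

lemma atom_code_6:
  "atom_code s (s+5) = concat (map (\<lambda>i. SymA (card (ones i)) #
     (if even i then [SymF (card (ones (i div 2)))] else [])) [s, s+1, s+2, s+3, s+4, s+5])"
proof -
  have "[s..<Suc (s+5)] = [s, s+1, s+2, s+3, s+4, s+5]"
    by (simp add: upt_conv_Cons)
  then show ?thesis unfolding atom_code_def weight_two_up by (simp only:)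
qed

text \<open>Each term contributes exactly one A symbol to the code.\<close>

lemma V_type_length:
  assumes "is_V_type s t"
  shows "t = s + 5"
proof -
  define isA where "isA c \<longleftrightarrow> (\<exists>w. c = SymA w)" for c
  have "length (filter isA (concat (map (\<lambda>i. SymA (f i) # (if even i then [SymF (g i)] else [])) xs))) = length xs"
    for f g :: "nat \<Rightarrow> nat" and xs
    by (induction xs) (auto simp: isA_def)
  then have "length (filter isA (atom_code s t)) = Suc t - s"
    by (simp add: atom_code_def del: upt_Suc)
  moreover have "length (filter isA (atom_code s t)) = 6"
    using assms by (simp add: is_V_type_def isA_def)
  ultimately show ?thesis by simp
qed

lemma V_type_9: "is_V_type 9 14"
proof -
  have "atom_code 9 14 = [SymA 2, SymA 1, SymF 2, SymA 1, SymA 1, SymF 1, SymA 2, SymA 1, SymF 1]"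
    using atom_code_6[of 9] by (simp add: initial_values)
  moreover have "is_atom 9 14"
    by (auto simp: is_atom_def initial_ends)
  ultimately show ?thesis by (simp add: is_V_type_def)
qed

lemma V_type_regular:
  assumes y: "y \<ge> 4" "Suc y \<notin> mu_set"
  shows "is_V_type (12*y+1) (12*y+6)"
proof -
  have b: "block y" "regular_block y"
    using block[OF y(1)] y(2) by (auto simp: block_def)
  have div: "(12*y+2) div 2 = 6*y+1" "(12*y+4) div 2 = 6*y+2" "(12*y+6) div 2 = 6*y+3"
    by auto
  have "12*y+1+1 = 12*y+2" "12*y+1+2 = 12*y+3" "12*y+1+3 = 12*y+4" "12*y+1+4 = 12*y+5"
    "12*y+1+5 = 12*y+6"
    by simp_all
  note code = atom_code_6[of "12*y+1", unfolded this]
  have lead: "lead y \<noteq> 4*y+1" "lead y div 2 \<noteq> 2*y+1" "lead y div 2 \<noteq> 4*y+2"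
    using y by (auto simp: lead_def)
  have "atom_code (12*y+1) (12*y+6) = [SymA 2, SymA 1, SymF 2, SymA 1, SymA 1, SymF 1, SymA 2, SymA 1, SymF 1]"
    unfolding code using b lead by (simp add: block_def regular_block_def div)
  moreover have "is_atom (12*y+1) (12*y+6)"
  proof -
    have "\<not> ends_atom i" if "i \<in> {12*y+1..<12*y+6}" for i
    proof -
      have "i - 12*y \<in> {1..12}" "i - 12*y < 6" "i = 12*y + (i - 12*y)" using that by auto
      then show ?thesis using ends_atom_block[OF y(1), of "i - 12*y"] y(2) by auto
    qed
    then show ?thesis
      using ends_atom_twelve[OF y(1)] ends_atom_block[OF y(1), of 6] y(2) by (auto simp: is_atom_def)
  qed
  ultimately show ?thesis by (simp add: is_V_type_def)
qed

text \<open>The index \<open>p\<close> before the atom is 0 or an atom end, and so is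
  \<open>p + 6\<close> an end. Few positions allow this, and the third code symbol excludes the
  wrong ones.\<close>

lemma V_type_cases:
  assumes "is_V_type s t"
  shows "s = 9 \<or> (\<exists>y\<ge>4. Suc y \<notin> mu_set \<and> s = 12*y+1)"
proof -
  have t: "t = s + 5" by (rule V_type_length[OF assms])
  define p where "p = s - 1"
  have s: "s = p + 1" "p = 0 \<or> ends_atom p"
    using assms by (auto simp: is_V_type_def is_atom_def p_def)
  then have "p + 6 = t" using t by simp
  then have s3: "ends_atom (p + 6)"
    using assms by (simp add: is_V_type_def is_atom_def)
  have code: "atom_code s (s+5) = [SymA 2, SymA 1, SymF 2, SymA 1, SymA 1, SymF 1, SymA 2, SymA 1, SymF 1]"
    using assms t by (simp add: is_V_type_def)
  have third: "card (ones ((p+2) div 2)) = 2" if "even p"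
    using code that unfolding atom_code_6 s(1) by (auto split: if_splits)
  show ?thesis
  proof (cases "p \<le> 48")
    case True
    then have "p = 8 \<or> p = 14 \<or> p = 48"
      using s(2) s3 initial_ends[of p] initial_ends[of "p + 6"] by auto
    \<comment> \<open>Six terms again, but the term freed at index 16 is a(8), of weight 1.\<close>
    moreover have "p \<noteq> 14"
      using third by (auto simp: initial_values)
    moreover have "s = 12 * 4 + 1" if "p = 48" using s that by simp
    ultimately show ?thesis
      using s(1) in_mu_set_small by auto
  next
    case False
    define y i where "y = (p - 1) div 12" and "i = Suc ((p - 1) mod 12)"
    have yi: "y \<ge> 4" "i \<in> {1..12}" "p = 12*y+i"
      using False by (auto simp: y_def i_def)
    then consider "i = 12" | "i = 6" "Suc y \<notin> mu_set" | "i = 8"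
      using ends_atom_block[OF yi(1,2)] s(2) by (auto split: if_splits)
    then show ?thesis
    proof cases
      case 1
      have "ends_atom (12*Suc y+6)" using s3 yi(3) 1 by (simp add: add.commute)
      then have "Suc (Suc y) \<notin> mu_set"
        using ends_atom_block[of "Suc y" 6] yi(1) by (auto split: if_splits)
      then show ?thesis using yi s 1 by (intro disjI2 exI[of _ "Suc y"]) simp
    next
      case 2
      \<comment> \<open>The second half of a regular block has six terms too, but it first frees a
        singleton.\<close>
      have single: "ones (6*y+4) = {4*y+4}"
        using block[OF yi(1)] 2 by (simp add: block_def regular_block_def)
      have idx: "(p+2) div 2 = 6*y+4" and even: "even p" using yi 2 by auto
      have "card (ones ((p+2) div 2)) = 1" unfolding idx using single by simp
      then show ?thesis using third[OF even] by simp
    next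
      case 3
      \<comment> \<open>The atom after position 8 of an exceptional block has only four terms, so
        six later there is no end.\<close>
      have "ends_atom (12*Suc y+2)" using s3 yi(3) 3 by (simp add: add.commute)
      then show ?thesis
        using ends_atom_block[of "Suc y" 2] yi(1) by (auto split: if_splits)
    qed
  qed
qed

lemma card_V_types_before:
  assumes "V_label k j"
  shows "card {s. s < 12 * mu (k + 4) + 12 * j + 1 \<and> (\<exists>t. is_V_type s t)} = 1 + V_label_rank k j"
proof -
  define Y where "Y = {y. 4 \<le> y \<and> y < mu (k + 4) + j \<and> Suc y \<notin> mu_set}"
  define N where "N = 12 * mu (k + 4) + 12 * j + 1"
  have "s = 9 \<or> s \<in> (\<lambda>y. 12*y+1) ` Y" if "s < N" "is_V_type s t" for s t
    using V_type_cases[OF that(2)] that(1) by (auto simp: Y_def N_def)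
  moreover have "s < N \<and> (\<exists>t. is_V_type s t)" if "s \<in> (\<lambda>y. 12*y+1) ` Y" for s
    using that V_type_regular by (auto simp: Y_def N_def)
  moreover have "9 < N"
    using mu_ge_4[of k] by (simp add: N_def)
  ultimately have "{s. s < N \<and> (\<exists>t. is_V_type s t)} = insert 9 ((\<lambda>y. 12*y+1) ` Y)"
    using V_type_9 by blast
  moreover have "9 \<notin> (\<lambda>y. 12*y+1) ` Y" "finite Y"
    by (auto simp: Y_def)
  moreover have "card ((\<lambda>y. 12*y+1) ` Y) = card Y"
    by (rule card_image) (auto simp: inj_on_def)
  ultimately show ?thesis
    using V_label_rank_eq[OF assms] by (simp add: Y_def N_def)
qed

section \<open>Values of the terms\<close>

lemma two_up_singleton: "ones n = {a} \<Longrightarrow> two_up n = 2 ^ a"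
  by (simp add: two_up_eq)

lemma two_up_pair: "ones n = {a, b} \<Longrightarrow> a \<noteq> b \<Longrightarrow> two_up n = 2 ^ a + 2 ^ b"
  by (simp add: two_up_eq)

lemma regular_block_values:
  assumes y: "y \<ge> 4" "Suc y \<notin> mu_set" and n: "n = 12*y+1"
  shows "two_up n = 2 ^ lead y + 2 ^ (4*y+1)" "two_up (n+1) = 2 ^ (8*y+2)"
    "two_up (n+2) = 2 ^ (8*y+3)" "two_up (n+3) = 2 ^ (8*y+4)"
    "two_up (n+4) = 2 ^ (lead y div 2) + 2 ^ (4*y+2)" "two_up (n+5) = 2 ^ (8*y+5)"
    "two_up (n+6) = 2 ^ (2*y+1) + 2 ^ (4*y+3)"
proof -
  have b: "block y" "regular_block y"
    using block[OF y(1)] y(2) by (auto simp: block_def)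
  have lead: "lead y \<noteq> 4*y+1" "lead y div 2 \<noteq> 4*y+2"
    using y by (auto simp: lead_def)
  have idx: "n+1 = 12*y+2" "n+2 = 12*y+3" "n+3 = 12*y+4" "n+4 = 12*y+5" "n+5 = 12*y+6" "n+6 = 12*y+7"
    using n by auto
  show "two_up n = 2 ^ lead y + 2 ^ (4*y+1)" "two_up (n+1) = 2 ^ (8*y+2)"
    "two_up (n+2) = 2 ^ (8*y+3)" "two_up (n+3) = 2 ^ (8*y+4)"
    "two_up (n+4) = 2 ^ (lead y div 2) + 2 ^ (4*y+2)" "two_up (n+5) = 2 ^ (8*y+5)"
    "two_up (n+6) = 2 ^ (2*y+1) + 2 ^ (4*y+3)"
    unfolding idx unfolding n using b lead
    by (intro two_up_pair two_up_singleton; simp add: block_def regular_block_def)+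
qed

theorem theorem6p3:
  fixes k j n :: nat
  assumes "j \<le> 2 ^ (k div 2 + 1) - 2"
    and "n = 12 * mu (k + 4) + 12 * j + 1"
  shows "is_V_atom k j n (n + 5) \<and>
    (j = 0 \<longrightarrow> (let x = 2 * mu (k + 4) in
        two_up n = 2 ^ (2 * x) + 2 ^ (2 * x + 1) \<and>
        two_up (n + 1) = 2 ^ (4 * x + 2) \<and>
        two_up (n + 2) = 2 ^ (4 * x + 3) \<and>
        two_up (n + 3) = 2 ^ (4 * x + 4) \<and>
        two_up (n + 4) = 2 ^ x + 2 ^ (2 * x + 2) \<and>
        two_up (n + 5) = 2 ^ (4 * x + 5) \<and>
        two_up (n + 6) = 2 ^ (x + 1) + 2 ^ (2 * x + 3))) \<and>
    (j > 0 \<longrightarrow> (let x = mu (k + 4) + j in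
        two_up n = 2 ^ (2 * x) + 2 ^ (4 * x + 1) \<and>
        two_up (n + 1) = 2 ^ (8 * x + 2) \<and>
        two_up (n + 2) = 2 ^ (8 * x + 3) \<and>
        two_up (n + 3) = 2 ^ (8 * x + 4) \<and>
        two_up (n + 4) = 2 ^ x + 2 ^ (4 * x + 2) \<and>
        two_up (n + 5) = 2 ^ (8 * x + 5) \<and>
        two_up (n + 6) = 2 ^ (2 * x + 1) + 2 ^ (4 * x + 3)))"
proof -
  define y where "y = mu (k + 4) + j"
  have V: "V_label k j" using assms(1) by (simp add: V_label_def)
  have y: "y \<ge> 4" "Suc y \<notin> mu_set" and n: "n = 12*y+1"
    using mu_ge_4[of k] V_label_regular[OF V] assms(2) by (simp_all add: y_def)
  have "n + 5 = 12*y+6" using n by simp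
  then have "is_V_type n (n + 5)"
    using V_type_regular[OF y] n by (simp only:)
  then have atom: "is_V_atom k j n (n + 5)"
    using V card_V_types_before[OF V] assms(2) by (simp add: is_V_atom_def)
  note vals = regular_block_values[OF y n]
  show ?thesis
  proof (cases "j = 0")
    case True
    \<comment> \<open>For j = 0 the block index lies in \<open>mu_set\<close>, so its leading
      exponent is 4y, which is 2x for x = 2y.\<close>
    then have "y = mu (k + 4)" "lead y = 4*y"
      using mu_in_mu_set[of k] by (simp_all add: y_def lead_def)
    then show ?thesis
      using atom vals True by (simp add: Let_def)
  next
    case False
    \<comment> \<open>For j > 0 the block index lies strictly between consecutive values of
      \<open>mu\<close>.\<close>
    then have "y \<notin> mu_set"
      using not_in_mu_set[of k y] V by (simp add: y_def V_label_iff)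
    then have "lead y = 2*y" by (simp add: lead_def)
    then show ?thesis
      using atom vals False by (simp add: Let_def flip: y_def)
  qed
qed

end
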